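(* Let $\Sigma$ be a set, $\Sigma_\tau=\Sigma+\{\tau\}$, and let $X$ be a set equipped with a labelled transition relation $\to\ \subseteq X\times(\Sigma_\tau\cup(0,\infty))\times X$ (the operational semantics of timed processes). Let $R$ be an equivalence relation on $X$. Then: (1) $R$ is a weak bisimulation on the lax functor $\underline{\alpha}=(\alpha^n)_{n\in\mathbb{N}}\in[\mathbb{N},\mathcal{K}l(\mathcal{P}^{\Sigma,[0,\infty)})]^{\mathsf{Set}}$ if and only if $R$ is a weak timed bisimulation; (2) $R$ is a weak bisimulation on $\underline{\alpha}$ viewed as the lax functor $\rho\in[\mathbb{N}\times[0,\infty),\mathcal{K}l(\mathcal{P}(\Sigma_\tau\times\mathcal{I}d))]^{\mathsf{Set}}$ if and only if $R$ is a weak time-abstract bisimulation.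
   Context: Monads: for a monoid $(M,\cdot,1)$, $\mathcal{P}^{\Sigma,M}X=\mathcal{P}(\Sigma_\tau\times M\times X)$ with unit $x\mapsto\{(\tau,1,x)\}$ and Kleisli composition $g\circ f(x)=\{(\sigma,m\cdot n,z)\mid\exists y:((\sigma,m,y)\in f(x),(\tau,n,z)\in g(y))\text{ or }((\tau,m,y)\in f(x),(\sigma,n,z)\in g(y))\}$; $\mathcal{P}(\Sigma_\tau\times\mathcal{I}d)$ is the case $M=1$. Kleisli hom-sets are ordered by pointwise inclusion (they are complete lattices, composition preserves unions in each variable). Functions $f$ embed as $f^\sharp(x)=\{(\tau,1,f(x))\}$. Define $\alpha:X\to\mathcal{P}(\Sigma_\tau\times[0,\infty)\times X)$, $\alpha(x)=\{(a,0,x')\mid x\xrightarrow{a}x',a\in\Sigma_\tau\}\cup\{(\tau,r,x')\mid x\xrightarrow{r}x',r\in(0,\infty)\}$, and $\underline{\alpha}_n=\alpha^n$ (Kleisli powers, $\alpha^0$ the identity), a lax functor from $(\mathbb{N},+,0)$. $\rho$ is defined by $\rho_{(n,t)}(x)=\{(\sigma,x')\mid(\sigma,t,x')\in\alpha^n(x)\}$ for $(n,t)$ in the product monoid $\mathbb{N}\times[0,\infty)$ (addition). Weak bisimulation on a lax functor $\pi=(\pi_m:X\to X)_{m\in M}$ from a monoid $M$ into such a Kleisli category $\mathsf{K}$ (a $\mathsf{DCpo}^\vee$-enriched category: hom-sets with directed suprema and binary joins, composition monotone and preserving directed suprema; size issues are ignored, as in the paper, by working in a small full subcategory containing the relevant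 sets): let $\widetilde{\mathsf{K}}$ be the category of lax functors $\mathsf{K}\to\mathsf{DCpo}^\vee$ (Scott-continuous maps between posets with directed sups and binary joins) and oplax transformations, ordered pointwise; $\widehat{Z}=\mathsf{K}(Z,-)$, $\widehat{g}=\mathsf{K}(g,-)$; $\widehat{\mathsf{K}}$ the full subcategory of $\widetilde{\mathsf{K}}^{op}$ on the $\widehat{Z}$; $\Theta:\widehat{\mathsf{K}}(\widehat{Z},\widehat{W})\to\mathsf{K}(Z,W)$, $\Theta(\phi)=\phi_W(id_W)$. Put $\Sigma_!(\widehat{\pi})=\bigvee_{l\in\mathbb{N}}(\bigvee_{m\in M}\widehat{\pi_m})^l$ in $\widehat{\mathsf{K}}$, where $\bigvee_{m\in M}$ is the supremum of the directed set of finite joins. A function $f:X\to Y$ is a weak behavioural morphism on $\pi$ if there is $\beta:Y\to Y$ in $\mathsf{K}$ with $\Theta(\widehat{f^\sharp}\circ\Sigma_!(\widehat{\pi}))=\Theta(\widehat{\beta}\circ\widehat{f^\sharp})$; an equivalence relation is a weak bisimulation on $\pi$ if it is the kernel $\{(x,x')\mid f(x)=f(x')\}$ of some weak behavioural morphism $f$. Timed notions: $x\overset{\tau}{\Rightarrow}y$ iff $x(\xrightarrow{\tau})^\ast y$; $x\overset{a}{\Rightarrow}y$ iff $x\overset{\tau}{\Rightarrow}\circ\xrightarrow{a}\circ\overset{\tau}{\Rightarrow}y$ for $a\in\Sigma$; $x\overset{t}{\Rightarrow}y$ iff $x\overset{\tau}{\Rightarrow}\circ\xrightarrow{t_1}\circ\overset{\tau}{\Rightarrow}\circ\cdots\circ\xrightarrow{t_n}\circ\overset{\tau}{\Rightarrow}y$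 with $t_i\in(0,\infty)$, $t=t_1+\dots+t_n$; $x\overset{\tau}{\multimap}y$ iff $x\overset{t}{\Rightarrow}y$ for some $t\in(0,\infty)$; $x\overset{a}{\multimap}y$ iff $x\overset{\tau}{\multimap}\circ\xrightarrow{a}\circ\overset{\tau}{\multimap}y$ for $a\in\Sigma$. $R$ is a weak timed bisimulation if whenever $(x,x')\in R$ and $x\overset{\sigma}{\Rightarrow}y$ with $\sigma\in\Sigma_\tau\cup(0,\infty)$, there is $y'$ with $x'\overset{\sigma}{\Rightarrow}y'$ and $(y,y')\in R$; it is a weak time-abstract bisimulation if whenever $(x,x')\in R$ and $x\overset{\sigma}{\multimap}y$ with $\sigma\in\Sigma_\tau$, there is $y'$ with $x'\overset{\sigma}{\multimap}y'$ and $(y,y')\in R$.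
   Formalization: In the time-abstract τ-step, the total delay t ranges over [0,∞) instead of (0,∞), where t=0 means only τ-steps; with (0,∞) part (2) fails, e.g. for X={x,y} with the single transition x –a→ y and R=X×X. *)

theory Defs
  imports Complex_Main "HOL-Algebra.Lattice" "HOL-Algebra.Elementary_Groups"
begin

section \<open>Order-enriched categories\<close>

text \<open>Hom-objects are posets in the sense of \<^theory>\<open>HOL-Algebra.Order\<close>. Arrows do not record
  their domain and codomain, so these are passed explicitly:
  \<open>cmp C X Y Z g f\<close> is the composite of \<open>f : X \<rightarrow> Y\<close> and \<open>g : Y \<rightarrow> Z\<close>.\<close>

record ('o, 'h) ocat =
  obj :: "'o set"
  arr :: "'o \<Rightarrow> 'o \<Rightarrow> 'h gorder"
  idn :: "'o \<Rightarrow> 'h"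
  cmp :: "'o \<Rightarrow> 'o \<Rightarrow> 'o \<Rightarrow> 'h \<Rightarrow> 'h \<Rightarrow> 'h"

primrec cpow :: "('o, 'h) ocat \<Rightarrow> 'o \<Rightarrow> 'h \<Rightarrow> nat \<Rightarrow> 'h" where
  "cpow C X f 0 = idn C X"
| "cpow C X f (Suc n) = cmp C X X X f (cpow C X f n)"

definition opposite :: "('o, 'h) ocat \<Rightarrow> ('o, 'h) ocat" where
  "opposite C = \<lparr>obj = obj C, arr = (\<lambda>X Y. arr C Y X), idn = idn C,
                 cmp = (\<lambda>X Y Z g f. cmp C Z Y X f g)\<rparr>"

definition full_subcat :: "('o, 'h) ocat \<Rightarrow> 'o set \<Rightarrow> ('o, 'h) ocat" where
  "full_subcat C A = C\<lparr>obj := obj C \<inter> A\<rparr>"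

definition monoid_cat :: "'m monoid \<Rightarrow> (unit, 'm) ocat" where
  "monoid_cat M = \<lparr>obj = UNIV,
     arr = (\<lambda>_ _. \<lparr>carrier = carrier M, eq = (=), le = (=)\<rparr>),
     idn = (\<lambda>_. \<one>\<^bsub>M\<^esub>),
     cmp = (\<lambda>_ _ _ m n. m \<otimes>\<^bsub>M\<^esub> n)\<rparr>"

definition directed :: "'a gorder \<Rightarrow> 'a set \<Rightarrow> bool" where
  "directed L D \<longleftrightarrow> D \<subseteq> carrier L \<and> D \<noteq> {} \<and>
     (\<forall>x\<in>D. \<forall>y\<in>D. \<exists>z\<in>D. x \<sqsubseteq>\<^bsub>L\<^esub> z \<and> y \<sqsubseteq>\<^bsub>L\<^esub> z)"

definition dcpo_join :: "'a gorder \<Rightarrow> bool" where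
  "dcpo_join L \<longleftrightarrow> upper_semilattice L \<and> (\<forall>D. directed L D \<longrightarrow> (\<exists>s. is_lub L s D))"

definition scott_continuous :: "'a gorder \<Rightarrow> 'b gorder \<Rightarrow> ('a \<Rightarrow> 'b) \<Rightarrow> bool" where
  "scott_continuous L L' f \<longleftrightarrow> f \<in> carrier L \<rightarrow>\<^sub>E carrier L' \<and>
     (\<forall>x\<in>carrier L. \<forall>y\<in>carrier L. x \<sqsubseteq>\<^bsub>L\<^esub> y \<longrightarrow> f x \<sqsubseteq>\<^bsub>L'\<^esub> f y) \<and>
     (\<forall>D s. directed L D \<longrightarrow> is_lub L s D \<longrightarrow> is_lub L' (f s) (f ` D))"

definition dcpo_join_cat :: "('a gorder, 'a \<Rightarrow> 'a) ocat" where
  "dcpo_join_cat = \<lparr>obj = {L. dcpo_join L},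
     arr = (\<lambda>L L'. \<lparr>carrier = {f. scott_continuous L L' f}, eq = (=),
                    le = (\<lambda>f g. \<forall>x\<in>carrier L. f x \<sqsubseteq>\<^bsub>L'\<^esub> g x)\<rparr>),
     idn = (\<lambda>L. \<lambda>x\<in>carrier L. x),
     cmp = (\<lambda>L _ _ g f. compose (carrier L) g f)\<rparr>"


section \<open>Lax functors and oplax transformations\<close>

record ('o, 'h, 'p, 'k) laxf =
  fobj :: "'o \<Rightarrow> 'p"
  farr :: "'o \<Rightarrow> 'o \<Rightarrow> 'h \<Rightarrow> 'k"

definition lax_functor :: "('o, 'h) ocat \<Rightarrow> ('p, 'k) ocat \<Rightarrow> ('o, 'h, 'p, 'k) laxf \<Rightarrow> bool" where
  "lax_functor C D F \<longleftrightarrow>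
     (\<forall>X\<in>obj C. fobj F X \<in> obj D) \<and>
     (\<forall>X\<in>obj C. \<forall>Y\<in>obj C. \<forall>f\<in>carrier (arr C X Y).
        farr F X Y f \<in> carrier (arr D (fobj F X) (fobj F Y))) \<and>
     (\<forall>X\<in>obj C. \<forall>Y\<in>obj C. \<forall>f\<in>carrier (arr C X Y). \<forall>g\<in>carrier (arr C X Y).
        f \<sqsubseteq>\<^bsub>arr C X Y\<^esub> g \<longrightarrow> farr F X Y f \<sqsubseteq>\<^bsub>arr D (fobj F X) (fobj F Y)\<^esub> farr F X Y g) \<and>
     (\<forall>X\<in>obj C. idn D (fobj F X) \<sqsubseteq>\<^bsub>arr D (fobj F X) (fobj F X)\<^esub> farr F X X (idn C X)) \<and>
     (\<forall>X\<in>obj C. \<forall>Y\<in>obj C. \<forall>Z\<in>obj C. \<forall>f\<in>carrier (arr C X Y). \<forall>g\<in>carrier (arr C Y Z).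
        cmp D (fobj F X) (fobj F Y) (fobj F Z) (farr F Y Z g) (farr F X Y f)
          \<sqsubseteq>\<^bsub>arr D (fobj F X) (fobj F Z)\<^esub> farr F X Z (cmp C X Y Z g f))"

definition oplax_transformation ::
    "('o, 'h) ocat \<Rightarrow> ('p, 'k) ocat \<Rightarrow> ('o, 'h, 'p, 'k) laxf \<Rightarrow> ('o, 'h, 'p, 'k) laxf
     \<Rightarrow> ('o \<Rightarrow> 'k) \<Rightarrow> bool" where
  "oplax_transformation C D F G \<phi> \<longleftrightarrow>
     \<phi> \<in> (\<Pi>\<^sub>E X\<in>obj C. carrier (arr D (fobj F X) (fobj G X))) \<and>
     (\<forall>X\<in>obj C. \<forall>Y\<in>obj C. \<forall>f\<in>carrier (arr C X Y).
        cmp D (fobj F X) (fobj F Y) (fobj G Y) (\<phi> Y) (farr F X Y f)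
          \<sqsubseteq>\<^bsub>arr D (fobj F X) (fobj G Y)\<^esub>
        cmp D (fobj F X) (fobj G X) (fobj G Y) (farr G X Y f) (\<phi> X))"

definition lax_functor_cat ::
    "('o, 'h) ocat \<Rightarrow> ('p, 'k) ocat \<Rightarrow> (('o, 'h, 'p, 'k) laxf, 'o \<Rightarrow> 'k) ocat" where
  "lax_functor_cat C D = \<lparr>obj = {F. lax_functor C D F},
     arr = (\<lambda>F G. \<lparr>carrier = {\<phi>. oplax_transformation C D F G \<phi>}, eq = (=),
              le = (\<lambda>\<phi> \<psi>. \<forall>X\<in>obj C. \<phi> X \<sqsubseteq>\<^bsub>arr D (fobj F X) (fobj G X)\<^esub> \<psi> X)\<rparr>),
     idn = (\<lambda>F. \<lambda>X\<in>obj C. idn D (fobj F X)),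
     cmp = (\<lambda>F G H \<psi> \<phi>. \<lambda>X\<in>obj C. cmp D (fobj F X) (fobj G X) (fobj H X) (\<psi> X) (\<phi> X))\<rparr>"


section \<open>The embedding into lax functors, and weak saturation\<close>

text \<open>\<open>hat_obj K Z\<close> is the lax functor \<open>K(Z,-)\<close>, and \<open>hat_arr K Z W g\<close> is \<open>K(g,-)\<close>. Because of the
  opposite, an arrow of \<open>hat_cat K\<close> from \<open>K(Z,-)\<close> to \<open>K(W,-)\<close> is an oplax transformation from
  \<open>K(W,-)\<close> to \<open>K(Z,-)\<close>.\<close>

definition hat_obj :: "('o, 'h) ocat \<Rightarrow> 'o \<Rightarrow> ('o, 'h, 'h gorder, 'h \<Rightarrow> 'h) laxf" where
  "hat_obj K Z = \<lparr>fobj = (\<lambda>V. arr K Z V),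
     farr = (\<lambda>V V' h. \<lambda>g\<in>carrier (arr K Z V). cmp K Z V V' h g)\<rparr>"

definition hat_arr :: "('o, 'h) ocat \<Rightarrow> 'o \<Rightarrow> 'o \<Rightarrow> 'h \<Rightarrow> ('o \<Rightarrow> 'h \<Rightarrow> 'h)" where
  "hat_arr K Z W g = (\<lambda>V\<in>obj K. \<lambda>h\<in>carrier (arr K W V). cmp K Z W V h g)"

definition hat_cat ::
    "('o, 'h) ocat \<Rightarrow> (('o, 'h, 'h gorder, 'h \<Rightarrow> 'h) laxf, 'o \<Rightarrow> 'h \<Rightarrow> 'h) ocat" where
  "hat_cat K = full_subcat (opposite (lax_functor_cat K dcpo_join_cat)) (hat_obj K ` obj K)"

definition Theta :: "('o, 'h) ocat \<Rightarrow> 'o \<Rightarrow> ('o \<Rightarrow> 'h \<Rightarrow> 'h) \<Rightarrow> 'h" where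
  "Theta K W \<phi> = \<phi> W (idn K W)"

text \<open>\<open>K\<close> is only assumed to have binary joins and directed suprema, so that finite joins are
  those of non-empty sets, and the supremum of a family is that of the directed set of its finite
  joins.\<close>

definition finite_joins :: "'a gorder \<Rightarrow> 'a set \<Rightarrow> 'a set" where
  "finite_joins L A = {\<Squnion>\<^bsub>L\<^esub> F |F. finite F \<and> F \<noteq> {} \<and> F \<subseteq> A}"

definition Sigma_bang ::
    "('o, 'h) ocat \<Rightarrow> 'm monoid \<Rightarrow> (unit, 'm, 'o, 'h) laxf \<Rightarrow> ('o \<Rightarrow> 'h \<Rightarrow> 'h)" where
  "Sigma_bang K M \<pi> =
     (let X = fobj \<pi> ();
          X' = hat_obj K X;
          H = arr (hat_cat K) X' X';
          S = \<Squnion>\<^bsub>H\<^esub> (finite_joins H ((\<lambda>m. hat_arr K X X (farr \<pi> () () m)) ` carrier M))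
      in \<Squnion>\<^bsub>H\<^esub> (range (cpow (hat_cat K) X' S)))"


section \<open>Kleisli categories\<close>

text \<open>The set \<open>\<Sigma>\<close> of visible actions is \<open>Sig\<close>, and \<open>None\<close> is \<open>\<tau>\<close>.\<close>

definition Sig_tau :: "'a set \<Rightarrow> 'a option set" where
  "Sig_tau Sig = insert None (Some ` Sig)"

text \<open>The objects are all subsets of the type \<open>'u\<close>, which plays the role of the universe in the
  small full subcategory of sets one works in.\<close>

definition kleisli :: "'a set \<Rightarrow> 'm monoid \<Rightarrow> ('u set, 'u \<Rightarrow> ('a option \<times> 'm \<times> 'u) set) ocat" where
  "kleisli Sig M = \<lparr>obj = UNIV,
     arr = (\<lambda>X Y. \<lparr>carrier = X \<rightarrow>\<^sub>E Pow (Sig_tau Sig \<times> carrier M \<times> Y), eq = (=),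
                    le = (\<lambda>f g. \<forall>x\<in>X. f x \<subseteq> g x)\<rparr>),
     idn = (\<lambda>X. \<lambda>x\<in>X. {(None, \<one>\<^bsub>M\<^esub>, x)}),
     cmp = (\<lambda>X Y Z g f. \<lambda>x\<in>X. {(\<sigma>, m \<otimes>\<^bsub>M\<^esub> n, z) | \<sigma> m n z.
              \<exists>y. ((\<sigma>, m, y) \<in> f x \<and> (None, n, z) \<in> g y) \<or>
                  ((None, m, y) \<in> f x \<and> (\<sigma>, n, z) \<in> g y)})\<rparr>"

definition sharp :: "'m monoid \<Rightarrow> 'u set \<Rightarrow> ('u \<Rightarrow> 'u) \<Rightarrow> ('u \<Rightarrow> ('a option \<times> 'm \<times> 'u) set)" where
  "sharp M X f = (\<lambda>x\<in>X. {(None, \<one>\<^bsub>M\<^esub>, f x)})"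

definition weak_behavioural_morphism ::
    "'a set \<Rightarrow> 'm monoid \<Rightarrow> 'n monoid
     \<Rightarrow> (unit, 'n, 'u set, 'u \<Rightarrow> ('a option \<times> 'm \<times> 'u) set) laxf
     \<Rightarrow> 'u set \<Rightarrow> ('u \<Rightarrow> 'u) \<Rightarrow> bool" where
  "weak_behavioural_morphism Sig M N \<pi> Y f \<longleftrightarrow>
     (let K = kleisli Sig M;
          X = fobj \<pi> ();
          X' = hat_obj K X;
          Y' = hat_obj K Y;
          f' = hat_arr K X Y (sharp M X f)
      in f \<in> X \<rightarrow> Y \<and>
         (\<exists>\<beta>\<in>carrier (arr K Y Y).
            Theta K Y (cmp (hat_cat K) X' X' Y' f' (Sigma_bang K N \<pi>)) =
            Theta K Y (cmp (hat_cat K) X' Y' Y' (hat_arr K Y Y \<beta>) f')))"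

definition weak_bisimulation ::
    "'a set \<Rightarrow> 'm monoid \<Rightarrow> 'n monoid
     \<Rightarrow> (unit, 'n, 'u set, 'u \<Rightarrow> ('a option \<times> 'm \<times> 'u) set) laxf \<Rightarrow> ('u \<times> 'u) set \<Rightarrow> bool" where
  "weak_bisimulation Sig M N \<pi> R \<longleftrightarrow>
     lax_functor (monoid_cat N) (kleisli Sig M) \<pi> \<and>
     equiv (fobj \<pi> ()) R \<and>
     (\<exists>Y f. weak_behavioural_morphism Sig M N \<pi> Y f \<and>
            R = {(x, x'). x \<in> fobj \<pi> () \<and> x' \<in> fobj \<pi> () \<and> f x = f x'})"


section \<open>Timed transition systems\<close>

definition nat_add :: "nat monoid" where
  "nat_add = \<lparr>carrier = UNIV, mult = (+), one = 0\<rparr>"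

definition nonneg_add :: "real monoid" where
  "nonneg_add = \<lparr>carrier = {0..}, mult = (+), one = 0\<rparr>"

text \<open>In \<open>(x, l, y) \<in> T\<close>, the label \<open>l\<close> is \<open>Inl \<sigma>\<close> for \<open>\<sigma> \<in> \<Sigma>\<^sub>\<tau>\<close> or \<open>Inr r\<close> for a delay \<open>r > 0\<close>.\<close>

type_synonym ('u, 'a) trans = "('u \<times> ('a option + real) \<times> 'u) set"

definition timed_alpha ::
    "'a set \<Rightarrow> 'u set \<Rightarrow> ('u, 'a) trans \<Rightarrow> 'u \<Rightarrow> ('a option \<times> real \<times> 'u) set" where
  "timed_alpha Sig X T = (\<lambda>x\<in>X.
     {(a, 0, x') | a x'. (x, Inl a, x') \<in> T \<and> a \<in> Sig_tau Sig} \<union>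
     {(None, r, x') | r x'. (x, Inr r, x') \<in> T \<and> r \<in> {0<..}})"

definition alpha_functor ::
    "'a set \<Rightarrow> 'u set \<Rightarrow> ('u, 'a) trans
     \<Rightarrow> (unit, nat, 'u set, 'u \<Rightarrow> ('a option \<times> real \<times> 'u) set) laxf" where
  "alpha_functor Sig X T = \<lparr>fobj = (\<lambda>_. X),
     farr = (\<lambda>_ _ n. cpow (kleisli Sig nonneg_add) X (timed_alpha Sig X T) n)\<rparr>"

text \<open>\<open>\<P>(\<Sigma>\<^sub>\<tau> \<times> Id)\<close> is the instance of the Kleisli construction for the one-element monoid
  \<open>singleton_group ()\<close>.\<close>

definition rho_functor ::
    "'a set \<Rightarrow> 'u set \<Rightarrow> ('u, 'a) trans
     \<Rightarrow> (unit, nat \<times> real, 'u set, 'u \<Rightarrow> ('a option \<times> unit \<times> 'u) set) laxf" where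
  "rho_functor Sig X T = \<lparr>fobj = (\<lambda>_. X),
     farr = (\<lambda>_ _ (n, t). \<lambda>x\<in>X. {(\<sigma>, (), x') | \<sigma> x'.
        (\<sigma>, t, x') \<in> cpow (kleisli Sig nonneg_add) X (timed_alpha Sig X T) n x})\<rparr>"

definition step :: "('u, 'a) trans \<Rightarrow> ('a option + real) \<Rightarrow> ('u \<times> 'u) set" where
  "step T l = {(x, y). (x, l, y) \<in> T}"

definition weak_tau :: "('u, 'a) trans \<Rightarrow> ('u \<times> 'u) set" where
  "weak_tau T = (step T (Inl None))\<^sup>*"

primrec delay_seq :: "('u, 'a) trans \<Rightarrow> real list \<Rightarrow> ('u \<times> 'u) set" where
  "delay_seq T [] = weak_tau T"
| "delay_seq T (t # ts) = weak_tau T O step T (Inr t) O delay_seq T ts"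

text \<open>For \<open>t = 0\<close> only the empty sequence of delays contributes, so \<open>weak_delay T 0 = weak_tau T\<close>.\<close>

definition weak_delay :: "('u, 'a) trans \<Rightarrow> real \<Rightarrow> ('u \<times> 'u) set" where
  "weak_delay T t = (\<Union>ts \<in> {ts. set ts \<subseteq> {0<..} \<and> sum_list ts = t}. delay_seq T ts)"

fun weak_step :: "('u, 'a) trans \<Rightarrow> ('a option + real) \<Rightarrow> ('u \<times> 'u) set" where
  "weak_step T (Inl None) = weak_tau T"
| "weak_step T (Inl (Some a)) = weak_tau T O step T (Inl (Some a)) O weak_tau T"
| "weak_step T (Inr t) = weak_delay T t"

definition weak_timed_bisimulation ::
    "'a set \<Rightarrow> ('u, 'a) trans \<Rightarrow> ('u \<times> 'u) set \<Rightarrow> bool" where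
  "weak_timed_bisimulation Sig T R \<longleftrightarrow>
     (\<forall>x x' y. \<forall>l\<in>Sig_tau Sig <+> {0<..}. (x, x') \<in> R \<longrightarrow> (x, y) \<in> weak_step T l \<longrightarrow>
        (\<exists>y'. (x', y') \<in> weak_step T l \<and> (y, y') \<in> R))"

text \<open>The total delay that is abstracted from ranges over \<open>[0,\<infinity>)\<close>, not over \<open>(0,\<infinity>)\<close>: the saturation
  of \<open>\<rho>\<close> contains the identity and the undelayed actions. With \<open>t > 0\<close>, a system whose only
  transition is \<open>x \<rightarrow> y\<close>, labelled by a visible action, would have no time-abstract step at all,
  and the total relation would be a time-abstract bisimulation although it is not a weak
  bisimulation on \<open>\<rho>\<close>.\<close>

definition abs_tau :: "('u, 'a) trans \<Rightarrow> ('u \<times> 'u) set" where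
  "abs_tau T = (\<Union>t \<in> {0..}. weak_delay T t)"

primrec abs_step :: "('u, 'a) trans \<Rightarrow> 'a option \<Rightarrow> ('u \<times> 'u) set" where
  "abs_step T None = abs_tau T"
| "abs_step T (Some a) = abs_tau T O step T (Inl (Some a)) O abs_tau T"

definition weak_time_abstract_bisimulation ::
    "'a set \<Rightarrow> ('u, 'a) trans \<Rightarrow> ('u \<times> 'u) set \<Rightarrow> bool" where
  "weak_time_abstract_bisimulation Sig T R \<longleftrightarrow>
     (\<forall>x x' y. \<forall>\<sigma>\<in>Sig_tau Sig. (x, x') \<in> R \<longrightarrow> (x, y) \<in> abs_step T \<sigma> \<longrightarrow>
        (\<exists>y'. (x', y') \<in> abs_step T \<sigma> \<and> (y, y') \<in> R))"

end

theory Submission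
  imports Defs
begin

text \<open>Composition in these Kleisli categories preserves unions on both sides. Hence the embedding into
  lax functors preserves suprema, and \<open>\<Theta>\<close> turns the defining equation of a weak behavioural morphism
  \<open>f\<close> into \<open>f\<^sup>\<sharp> \<circ> P = \<beta> \<circ> f\<^sup>\<sharp>\<close>, where \<open>P\<close> is the saturation of the \<open>\<pi>\<^sub>m\<close> under unions and powers;
  for a lax functor \<open>P\<close> is just their union. Some \<open>\<beta>\<close> exists iff the steps of \<open>P\<close> can be transferred
  along the kernel of \<open>f\<close>. For the two functors of a timed system, the steps of \<open>P\<close> are sequences of
  internal steps and delays with at most one visible action in between. In (1) a visible action may
  be surrounded by delays, but such a step splits into timed steps that are matched one by one.\<close>

section \<open>Uniqueness of suprema\<close>

lemma is_lub_unique_antisym: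
  assumes "is_lub L s A" "is_lub L t A"
    and antisym: "\<And>x y. x \<in> carrier L \<Longrightarrow> y \<in> carrier L \<Longrightarrow> x \<sqsubseteq>\<^bsub>L\<^esub> y \<Longrightarrow> y \<sqsubseteq>\<^bsub>L\<^esub> x \<Longrightarrow> x = y"
  shows "s = t"
proof -
  have "s \<in> Upper L A" "t \<in> Upper L A" "s \<sqsubseteq>\<^bsub>L\<^esub> t" "t \<sqsubseteq>\<^bsub>L\<^esub> s"
    using assms(1,2) by (auto simp: least_def)
  then show ?thesis using antisym by (auto simp: Upper_def)
qed

text \<open>\<open>sup\<close> chooses among all least upper bounds, so antisymmetry makes any least
  upper bound that can be exhibited equal to the chosen one. Antisymmetry is a bare premise so that
  it can be supplied directly for each kind of hom-set.\<close>

lemma sup_eq_is_lub: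
  assumes "is_lub L s A"
    and "\<And>x y. x \<in> carrier L \<Longrightarrow> y \<in> carrier L \<Longrightarrow> x \<sqsubseteq>\<^bsub>L\<^esub> y \<Longrightarrow> y \<sqsubseteq>\<^bsub>L\<^esub> x \<Longrightarrow> x = y"
  shows "\<Squnion>\<^bsub>L\<^esub> A = s"
proof -
  have "is_lub L (SOME x. is_lub L x A) A"
    using assms(1) by (rule someI)
  then show ?thesis
    unfolding sup_def using assms by (rule is_lub_unique_antisym)
qed

lemma finite_joins_eq:
  "finite_joins L A = (\<lambda>F. \<Squnion>\<^bsub>L\<^esub> F) ` {F. finite F \<and> F \<noteq> {} \<and> F \<subseteq> A}"
  by (auto simp: finite_joins_def)

section \<open>Unions of Kleisli arrows\<close>

text \<open>The restriction to \<open>X\<close> keeps the union extensional, as the arrows of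
  \<open>K\<close> are; for empty \<open>G\<close> it is the arrow with constant value
  \<open>{}\<close>.\<close>

definition ksup :: "'u set \<Rightarrow> ('u \<Rightarrow> 'b set) set \<Rightarrow> 'u \<Rightarrow> 'b set" where
  "ksup X G = (\<lambda>x\<in>X. \<Union>g\<in>G. g x)"

lemma ksup_iff: "x \<in> X \<Longrightarrow> p \<in> ksup X G x \<longleftrightarrow> (\<exists>g\<in>G. p \<in> g x)"
  by (simp add: ksup_def)

lemma ksup_outside: "x \<notin> X \<Longrightarrow> ksup X G x = undefined"
  by (simp add: ksup_def)

locale kleisli_category = monoid M for M :: "'m monoid" (structure) + fixes Sig :: "'a set"
begin

abbreviation K :: "('u set, 'u \<Rightarrow> ('a option \<times> 'm \<times> 'u) set) ocat" where
  "K \<equiv> kleisli Sig M"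

lemma obj_K [simp]: "obj K = UNIV"
  by (simp add: kleisli_def)

lemma carrier_K: "carrier (arr K X Y) = X \<rightarrow>\<^sub>E Pow (Sig_tau Sig \<times> carrier M \<times> Y)"
  by (simp add: kleisli_def)

lemma le_K: "f \<sqsubseteq>\<^bsub>arr K X Y\<^esub> g \<longleftrightarrow> (\<forall>x\<in>X. f x \<subseteq> g x)"
  by (simp add: kleisli_def)

lemma in_carrier_K:
  assumes "f \<in> carrier (arr K X Y)" "x \<in> X" "(\<sigma>, m, y) \<in> f x"
  shows "\<sigma> \<in> Sig_tau Sig" "m \<in> carrier M" "y \<in> Y"
  using assms unfolding carrier_K by (fastforce simp: PiE_iff)+

lemma carrier_K_eqI:
  assumes "f \<in> carrier (arr K X Y)" "g \<in> carrier (arr K X Y)"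
    and "\<And>x \<sigma> m y. x \<in> X \<Longrightarrow> (\<sigma>, m, y) \<in> f x \<longleftrightarrow> (\<sigma>, m, y) \<in> g x"
  shows "f = g"
  using assms unfolding carrier_K by (intro PiE_ext) (auto simp: set_eq_iff)

lemma antisym_K:
  assumes "f \<in> carrier (arr K X Y)" "g \<in> carrier (arr K X Y)"
    and "f \<sqsubseteq>\<^bsub>arr K X Y\<^esub> g" "g \<sqsubseteq>\<^bsub>arr K X Y\<^esub> f"
  shows "f = g"
  using assms unfolding le_K carrier_K by (intro PiE_ext) auto

lemma cmp_K:
  assumes "x \<in> X"
  shows "(\<sigma>, k, z) \<in> cmp K X Y Z g f x \<longleftrightarrow> (\<exists>m n y. k = m \<otimes> n \<and>
           ((\<sigma>, m, y) \<in> f x \<and> (None, n, z) \<in> g y \<or> (None, m, y) \<in> f x \<and> (\<sigma>, n, z) \<in> g y))"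
  using assms by (auto simp: kleisli_def)

lemma cmp_K_I1:
  "x \<in> X \<Longrightarrow> (\<sigma>, m, y) \<in> f x \<Longrightarrow> (None, n, z) \<in> g y \<Longrightarrow> (\<sigma>, m \<otimes> n, z) \<in> cmp K X Y Z g f x"
  by (auto simp: cmp_K)

lemma cmp_K_I2:
  "x \<in> X \<Longrightarrow> (None, m, y) \<in> f x \<Longrightarrow> (\<sigma>, n, z) \<in> g y \<Longrightarrow> (\<sigma>, m \<otimes> n, z) \<in> cmp K X Y Z g f x"
  by (auto simp: cmp_K)

lemma cmp_K_outside: "x \<notin> X \<Longrightarrow> cmp K X Y Z g f x = undefined"
  by (simp add: kleisli_def)

lemma idn_K: "x \<in> X \<Longrightarrow> p \<in> idn K X x \<longleftrightarrow> p = (None, \<one>, x)"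
  by (simp add: kleisli_def)

lemma idn_carrier_K [simp]: "idn K X \<in> carrier (arr K X X)"
  by (auto simp: kleisli_def Sig_tau_def)

lemma cmp_carrier_K [simp]:
  assumes "f \<in> carrier (arr K X Y)" "g \<in> carrier (arr K Y Z)"
  shows "cmp K X Y Z g f \<in> carrier (arr K X Z)"
proof -
  have "(\<sigma>, k, z) \<in> Sig_tau Sig \<times> carrier M \<times> Z"
    if x: "x \<in> X" and "(\<sigma>, k, z) \<in> cmp K X Y Z g f x" for x \<sigma> k z
  proof -
    obtain m n y where k: "k = m \<otimes> n" and
      "(\<sigma>, m, y) \<in> f x \<and> (None, n, z) \<in> g y \<or> (None, m, y) \<in> f x \<and> (\<sigma>, n, z) \<in> g y"
      using \<open>(\<sigma>, k, z) \<in> _\<close> unfolding cmp_K[OF x] by blast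
    moreover from this have "y \<in> Y" "m \<in> carrier M" using in_carrier_K[OF assms(1) x] by auto
    ultimately show ?thesis
      using in_carrier_K(1)[OF assms(1) x] in_carrier_K[OF assms(2)] k by auto
  qed
  then show ?thesis unfolding carrier_K
    by (intro PiE_I) (auto simp: cmp_K_outside)
qed

section \<open>The category laws for Kleisli arrows\<close>

lemma cmp_idn_left:
  assumes "f \<in> carrier (arr K X Y)"
  shows "cmp K X Y Y (idn K Y) f = f"
proof (rule carrier_K_eqI[of _ X Y])
  fix x \<sigma> m y assume x: "x \<in> X"
  show "(\<sigma>, m, y) \<in> cmp K X Y Y (idn K Y) f x \<longleftrightarrow> (\<sigma>, m, y) \<in> f x"
  proof
    assume "(\<sigma>, m, y) \<in> cmp K X Y Y (idn K Y) f x"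
    then show "(\<sigma>, m, y) \<in> f x"
      using in_carrier_K[OF assms x] by (auto simp: cmp_K x idn_K)
  next
    assume *: "(\<sigma>, m, y) \<in> f x"
    then show "(\<sigma>, m, y) \<in> cmp K X Y Y (idn K Y) f x"
      using cmp_K_I1[of x X \<sigma> m y f \<one> y "idn K Y" Y Y] x in_carrier_K[OF assms x *]
      by (simp add: idn_K)
  qed
qed (use assms in auto)

lemma cmp_idn_right:
  assumes "f \<in> carrier (arr K X Y)"
  shows "cmp K X X Y f (idn K X) = f"
proof (rule carrier_K_eqI[of _ X Y])
  fix x \<sigma> m y assume x: "x \<in> X"
  show "(\<sigma>, m, y) \<in> cmp K X X Y f (idn K X) x \<longleftrightarrow> (\<sigma>, m, y) \<in> f x"
  proof
    assume "(\<sigma>, m, y) \<in> cmp K X X Y f (idn K X) x"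
    then show "(\<sigma>, m, y) \<in> f x"
      using in_carrier_K[OF assms x] by (auto simp: cmp_K x idn_K)
  next
    assume *: "(\<sigma>, m, y) \<in> f x"
    then show "(\<sigma>, m, y) \<in> cmp K X X Y f (idn K X) x"
      using cmp_K_I2[of x X \<one> x "idn K X" \<sigma> m y f X Y] in_carrier_K[OF assms x *]
      by (simp add: idn_K x)
  qed
qed (use assms in auto)

text \<open>Both bracketings unfold to the same three cases, according to which of the three factors
  carries the label \<sigma> while the other two carry \<open>None\<close>. The times then agree by
  associativity; the membership facts are collected because \<open>m_assoc\<close> holds on the
  carrier only.\<close>

lemma cmp_K_assoc:
  assumes f: "f \<in> carrier (arr K X Y)" and g: "g \<in> carrier (arr K Y Z)"
    and h: "h \<in> carrier (arr K Z W)"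
  shows "cmp K X Y W (cmp K Y Z W h g) f = cmp K X Z W h (cmp K X Y Z g f)"
proof (rule carrier_K_eqI[of _ X W])
  fix x \<sigma> k w assume x: "x \<in> X"
  note fc = in_carrier_K[OF f x] and gc = in_carrier_K[OF g] and hc = in_carrier_K[OF h]
  show "(\<sigma>, k, w) \<in> cmp K X Y W (cmp K Y Z W h g) f x \<longleftrightarrow>
        (\<sigma>, k, w) \<in> cmp K X Z W h (cmp K X Y Z g f) x" (is "?l \<longleftrightarrow> ?r")
  proof
    assume ?l
    then obtain m n y where k: "k = m \<otimes> n" and
      *: "(\<sigma>, m, y) \<in> f x \<and> (None, n, w) \<in> cmp K Y Z W h g y \<or>
          (None, m, y) \<in> f x \<and> (\<sigma>, n, w) \<in> cmp K Y Z W h g y"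
      unfolding cmp_K[OF x] by blast
    then have y: "y \<in> Y" and m: "m \<in> carrier M" using fc by auto
    from * obtain n1 n2 z where n: "n = n1 \<otimes> n2" and
      **: "(\<sigma>, m, y) \<in> f x \<and> (None, n1, z) \<in> g y \<and> (None, n2, w) \<in> h z \<or>
          (None, m, y) \<in> f x \<and> (\<sigma>, n1, z) \<in> g y \<and> (None, n2, w) \<in> h z \<or>
          (None, m, y) \<in> f x \<and> (None, n1, z) \<in> g y \<and> (\<sigma>, n2, w) \<in> h z"
      unfolding cmp_K[OF y] by blast
    then have "z \<in> Z" "n1 \<in> carrier M" using gc[OF y] by auto
    moreover from this ** have "n2 \<in> carrier M" using hc by auto
    ultimately have "k = (m \<otimes> n1) \<otimes> n2" using k n m by (simp add: m_assoc)
    with ** show ?r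
      by (elim disjE conjE) (auto intro: cmp_K_I1[OF x] cmp_K_I2[OF x])
  next
    assume ?r
    then obtain m n z where k: "k = m \<otimes> n" and
      *: "(\<sigma>, m, z) \<in> cmp K X Y Z g f x \<and> (None, n, w) \<in> h z \<or>
          (None, m, z) \<in> cmp K X Y Z g f x \<and> (\<sigma>, n, w) \<in> h z"
      unfolding cmp_K[OF x] by blast
    from * obtain m1 m2 y where m: "m = m1 \<otimes> m2" and
      **: "(\<sigma>, m1, y) \<in> f x \<and> (None, m2, z) \<in> g y \<and> (None, n, w) \<in> h z \<or>
          (None, m1, y) \<in> f x \<and> (\<sigma>, m2, z) \<in> g y \<and> (None, n, w) \<in> h z \<or>
          (None, m1, y) \<in> f x \<and> (None, m2, z) \<in> g y \<and> (\<sigma>, n, w) \<in> h z"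
      unfolding cmp_K[OF x] by blast
    then have y: "y \<in> Y" and m1: "m1 \<in> carrier M" using fc by auto
    then have "z \<in> Z" "m2 \<in> carrier M" using ** gc[OF y] by auto
    moreover from this ** have "n \<in> carrier M" using hc by auto
    ultimately have "k = m1 \<otimes> (m2 \<otimes> n)" using k m m1 by (simp add: m_assoc)
    with ** show ?l
      by (elim disjE conjE) (auto intro: cmp_K_I1[OF x] cmp_K_I2[OF x] cmp_K_I1[OF y] cmp_K_I2[OF y])
  qed
qed (use assms in auto)

lemma cpow_carrier_K [simp]:
  "f \<in> carrier (arr K X X) \<Longrightarrow> cpow K X f n \<in> carrier (arr K X X)"
  by (induction n) auto

lemma cmp_cpow_K:
  assumes "f \<in> carrier (arr K X X)"
  shows "cmp K X X X (cpow K X f m) (cpow K X f n) = cpow K X f (m + n)"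
  by (induction m) (use assms in \<open>auto simp: cmp_idn_left cmp_K_assoc\<close>)

section \<open>Unions as suprema, and their preservation by composition\<close>

lemma ksup_carrier_K [simp]:
  "G \<subseteq> carrier (arr K X Y) \<Longrightarrow> ksup X G \<in> carrier (arr K X Y)"
  unfolding carrier_K ksup_def by (intro PiE_I PowI UN_least) (auto simp: PiE_iff subset_iff)

lemma ksup_is_lub:
  "G \<subseteq> carrier (arr K X Y) \<Longrightarrow> is_lub (arr K X Y) (ksup X G) G"
  using ksup_carrier_K[of G X Y] unfolding least_def Upper_def le_K
  by (auto simp: ksup_iff subset_iff)

text \<open>Suprema are unique by antisymmetry, so an abstractly given one, as in the definition of
  Scott continuity, can be replaced by a union.\<close>

lemma is_lub_K_iff:
  assumes "G \<subseteq> carrier (arr K X Y)"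
  shows "is_lub (arr K X Y) s G \<longleftrightarrow> s = ksup X G"
  using is_lub_unique_antisym[OF _ ksup_is_lub[OF assms] antisym_K[of _ X Y]] ksup_is_lub[OF assms]
  by blast

text \<open>Each triple in a composite is witnessed by a single triple of the left factor, so the
  choice of \<open>g\<close> in \<open>G\<close> can be pulled out. The typing of \<open>f\<close>
  puts the intermediate points into \<open>Y\<close>, where \<open>ksup Y G\<close> is the union and
  not \<open>undefined\<close>.\<close>

lemma cmp_ksup_left:
  assumes "f \<in> carrier (arr K X Y)"
  shows "cmp K X Y Z (ksup Y G) f = ksup X ((\<lambda>g. cmp K X Y Z g f) ` G)"
proof
  fix x
  show "cmp K X Y Z (ksup Y G) f x = ksup X ((\<lambda>g. cmp K X Y Z g f) ` G) x"
  proof (cases "x \<in> X")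
    case x: True
    have "(\<sigma>, k, z) \<in> cmp K X Y Z (ksup Y G) f x \<longleftrightarrow> (\<exists>g\<in>G. (\<sigma>, k, z) \<in> cmp K X Y Z g f x)"
      for \<sigma> k z
    proof -
      have "(\<sigma>', n, z) \<in> ksup Y G y \<longleftrightarrow> (\<exists>g\<in>G. (\<sigma>', n, z) \<in> g y)"
        if "(\<sigma>'', m, y) \<in> f x" for \<sigma>' \<sigma>'' m n y
        using in_carrier_K(3)[OF assms x that] by (rule ksup_iff)
      then show ?thesis unfolding cmp_K[OF x] by blast
    qed
    then show ?thesis using x by (auto simp: ksup_iff)
  qed (simp add: ksup_outside cmp_K_outside)
qed

lemma cmp_ksup_right: "cmp K X Y Z g (ksup X F) = ksup X ((\<lambda>f. cmp K X Y Z g f) ` F)"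
proof
  fix x
  show "cmp K X Y Z g (ksup X F) x = ksup X ((\<lambda>f. cmp K X Y Z g f) ` F) x"
  proof (cases "x \<in> X")
    case x: True
    have "(\<sigma>, k, z) \<in> cmp K X Y Z g (ksup X F) x \<longleftrightarrow> (\<exists>f\<in>F. (\<sigma>, k, z) \<in> cmp K X Y Z g f x)"
      for \<sigma> k z
      unfolding cmp_K[OF x] ksup_iff[OF x] by blast
    then show ?thesis using x by (auto simp: ksup_iff)
  qed (simp add: ksup_outside cmp_K_outside)
qed

lemma cmp_mono_K:
  assumes "h \<sqsubseteq>\<^bsub>arr K Y Z\<^esub> h'" "g \<in> carrier (arr K X Y)"
  shows "cmp K X Y Z h g \<sqsubseteq>\<^bsub>arr K X Z\<^esub> cmp K X Y Z h' g"
proof -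
  have "(\<sigma>, k, z) \<in> cmp K X Y Z h' g x" if x: "x \<in> X" and "(\<sigma>, k, z) \<in> cmp K X Y Z h g x" for x \<sigma> k z
    using that(2) in_carrier_K(3)[OF assms(2) x] assms(1) unfolding cmp_K[OF x] le_K by blast
  then show ?thesis by (auto simp: le_K)
qed

section \<open>Saturation in the lax functor category\<close>

abbreviation H :: "'u set \<Rightarrow> 'u set
    \<Rightarrow> ('u set \<Rightarrow> ('u \<Rightarrow> ('a option \<times> 'm \<times> 'u) set) \<Rightarrow> ('u \<Rightarrow> ('a option \<times> 'm \<times> 'u) set)) gorder" where
  "H X Y \<equiv> arr (hat_cat K) (hat_obj K X) (hat_obj K Y)"

lemma carrier_H: "carrier (H X Y) =
    {\<phi>. oplax_transformation K dcpo_join_cat (hat_obj K Y) (hat_obj K X) \<phi>}"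
  by (simp add: hat_cat_def full_subcat_def opposite_def lax_functor_cat_def)

lemma le_H: "\<phi> \<sqsubseteq>\<^bsub>H X Y\<^esub> \<psi> \<longleftrightarrow>
    (\<forall>V. \<forall>h\<in>carrier (arr K Y V). \<phi> V h \<sqsubseteq>\<^bsub>arr K X V\<^esub> \<psi> V h)"
  by (simp add: hat_cat_def full_subcat_def opposite_def lax_functor_cat_def hat_obj_def
      dcpo_join_cat_def)

text \<open>The factors swap because of the opposite: the arrow that comes second in
  \<open>hat_cat K\<close> acts first on an argument \<open>h\<close>.\<close>

lemma cmp_H: "cmp (hat_cat K) (hat_obj K X) (hat_obj K Y) (hat_obj K Z) \<psi> \<phi> =
    (\<lambda>V\<in>UNIV. compose (carrier (arr K Z V)) (\<phi> V) (\<psi> V))"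
  by (simp add: hat_cat_def full_subcat_def opposite_def lax_functor_cat_def hat_obj_def
      dcpo_join_cat_def)

lemma idn_H: "idn (hat_cat K) (hat_obj K X) = (\<lambda>V\<in>UNIV. \<lambda>h\<in>carrier (arr K X V). h)"
  by (simp add: hat_cat_def full_subcat_def opposite_def lax_functor_cat_def hat_obj_def
      dcpo_join_cat_def)

lemma in_carrier_H:
  assumes "\<phi> \<in> carrier (H X Y)"
  shows "\<phi> V \<in> carrier (arr K Y V) \<rightarrow>\<^sub>E carrier (arr K X V)"
  using assms unfolding carrier_H
  by (auto simp: oplax_transformation_def dcpo_join_cat_def hat_obj_def scott_continuous_def)

lemma antisym_H:
  assumes "\<phi> \<in> carrier (H X Y)" "\<psi> \<in> carrier (H X Y)"
    and "\<phi> \<sqsubseteq>\<^bsub>H X Y\<^esub> \<psi>" "\<psi> \<sqsubseteq>\<^bsub>H X Y\<^esub> \<phi>"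
  shows "\<phi> = \<psi>"
proof
  fix V
  show "\<phi> V = \<psi> V"
  proof (rule PiE_ext[OF in_carrier_H[OF assms(1)] in_carrier_H[OF assms(2)]])
    fix h assume "h \<in> carrier (arr K Y V)"
    then show "\<phi> V h = \<psi> V h"
      using assms(3,4) in_carrier_H[OF assms(1), of V] in_carrier_H[OF assms(2), of V]
      unfolding le_H by (intro antisym_K) auto
  qed
qed

section \<open>The embedding of the Kleisli category into lax functors\<close>

lemma hat_arr_app:
  "h \<in> carrier (arr K Y V) \<Longrightarrow> hat_arr K X Y g V h = cmp K X Y V h g"
  by (simp add: hat_arr_def)

text \<open>Precomposition with \<open>g\<close> preserves directed suprema because these are
  unions. The oplax inequality holds as an equality: by associativity, precomposition commutes with
  postcomposition.\<close>

lemma hat_arr_carrier: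
  fixes X Y :: "'u set"
  assumes g: "g \<in> carrier (arr K X Y)"
  shows "hat_arr K X Y g \<in> carrier (H X Y)"
proof -
  have sc: "scott_continuous (arr K Y V) (arr K X V) (hat_arr K X Y g V)" for V
    unfolding scott_continuous_def
  proof (intro conjI allI impI ballI)
    show "hat_arr K X Y g V \<in> carrier (arr K Y V) \<rightarrow>\<^sub>E carrier (arr K X V)"
      using g by (auto simp: hat_arr_def)
  next
    fix h h' assume "h \<in> carrier (arr K Y V)" "h' \<in> carrier (arr K Y V)" "h \<sqsubseteq>\<^bsub>arr K Y V\<^esub> h'"
    then show "hat_arr K X Y g V h \<sqsubseteq>\<^bsub>arr K X V\<^esub> hat_arr K X Y g V h'"
      using cmp_mono_K g by (simp add: hat_arr_app)
  next
    fix D s assume "directed (arr K Y V) D" and lub: "is_lub (arr K Y V) s D"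
    then have D: "D \<subseteq> carrier (arr K Y V)" by (simp add: directed_def)
    then have s: "s = ksup Y D" using lub is_lub_K_iff by blast
    have "hat_arr K X Y g V ` D = (\<lambda>h. cmp K X Y V h g) ` D"
      using D by (intro image_cong) (auto simp: hat_arr_app)
    moreover have "hat_arr K X Y g V s = ksup X ((\<lambda>h. cmp K X Y V h g) ` D)"
      using D g by (simp add: s hat_arr_app cmp_ksup_left)
    moreover have "(\<lambda>h. cmp K X Y V h g) ` D \<subseteq> carrier (arr K X V)"
      using D g by auto
    ultimately show "is_lub (arr K X V) (hat_arr K X Y g V s) (hat_arr K X Y g V ` D)"
      using ksup_is_lub by simp
  qed
  have "oplax_transformation K dcpo_join_cat (hat_obj K Y) (hat_obj K X) (hat_arr K X Y g)"
    unfolding oplax_transformation_def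
  proof (intro conjI ballI)
    show "hat_arr K X Y g \<in> (\<Pi>\<^sub>E V\<in>obj K. carrier
        (arr dcpo_join_cat (fobj (hat_obj K Y) V) (fobj (hat_obj K X) V)))"
      using sc by (auto simp: dcpo_join_cat_def hat_obj_def)
  next
    fix V W :: "'u set" and h assume h: "h \<in> carrier (arr K V W)"
    show "cmp dcpo_join_cat (fobj (hat_obj K Y) V) (fobj (hat_obj K Y) W) (fobj (hat_obj K X) W)
            (hat_arr K X Y g W) (farr (hat_obj K Y) V W h)
          \<sqsubseteq>\<^bsub>arr dcpo_join_cat (fobj (hat_obj K Y) V) (fobj (hat_obj K X) W)\<^esub>
          cmp dcpo_join_cat (fobj (hat_obj K Y) V) (fobj (hat_obj K X) V) (fobj (hat_obj K X) W)
            (farr (hat_obj K X) V W h) (hat_arr K X Y g V)"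
      using h g by (simp add: dcpo_join_cat_def hat_obj_def compose_def hat_arr_app cmp_K_assoc le_K)
  qed
  then show ?thesis by (simp add: carrier_H)
qed

text \<open>Precomposition reverses composites and the opposite category reverses them back, so the
  embedding is covariant.\<close>

lemma hat_arr_cmp:
  assumes "f \<in> carrier (arr K X Y)" "g \<in> carrier (arr K Y Z)"
  shows "cmp (hat_cat K) (hat_obj K X) (hat_obj K Y) (hat_obj K Z) (hat_arr K Y Z g) (hat_arr K X Y f)
       = hat_arr K X Z (cmp K X Y Z g f)"
  unfolding cmp_H using assms
  by (auto simp: fun_eq_iff compose_def hat_arr_def cmp_K_assoc restrict_def)

lemma hat_arr_idn: "idn (hat_cat K) (hat_obj K X) = hat_arr K X X (idn K X)"
  unfolding idn_H by (auto simp: fun_eq_iff hat_arr_def cmp_idn_right restrict_def)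

lemma hat_arr_cpow:
  "f \<in> carrier (arr K X X) \<Longrightarrow>
   cpow (hat_cat K) (hat_obj K X) (hat_arr K X X f) n = hat_arr K X X (cpow K X f n)"
  by (induction n) (auto simp: hat_arr_idn hat_arr_cmp)

text \<open>The Yoneda argument: evaluation at the identity recovers the embedded arrow. This lets
  equations between embedded arrows be read off in \<open>K\<close>.\<close>

lemma hat_arr_Theta:
  "f \<in> carrier (arr K X Y) \<Longrightarrow> Theta K Y (hat_arr K X Y f) = f"
  by (simp add: Theta_def hat_arr_app cmp_idn_left)

text \<open>The supremum is pointwise: at each \<open>V\<close> and \<open>h\<close>, the union of
  the composites of \<open>h\<close> with members of \<open>G\<close> is the composite of
  \<open>h\<close> with \<open>ksup X G\<close>, as composition preserves unions on the right. An
  upper bound \<psi> dominates every member of this union, hence the union.\<close>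

lemma sup_hat_arr:
  assumes G: "G \<subseteq> carrier (arr K X Y)"
  shows "\<Squnion>\<^bsub>H X Y\<^esub> (hat_arr K X Y ` G) = hat_arr K X Y (ksup X G)"
proof (rule sup_eq_is_lub[OF _ antisym_H[of _ X Y]])
  have *: "is_lub (arr K X V) (cmp K X Y V h (ksup X G)) ((\<lambda>g. cmp K X Y V h g) ` G)"
    if "h \<in> carrier (arr K Y V)" for V h
    unfolding cmp_ksup_right using that G by (intro ksup_is_lub) auto
  show "is_lub (H X Y) (hat_arr K X Y (ksup X G)) (hat_arr K X Y ` G)"
  proof (rule least_UpperI)
    fix \<phi> assume "\<phi> \<in> hat_arr K X Y ` G"
    then show "\<phi> \<sqsubseteq>\<^bsub>H X Y\<^esub> hat_arr K X Y (ksup X G)"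
      using * G unfolding le_H by (auto simp: hat_arr_app least_def Upper_def)
  next
    fix \<psi> assume \<psi>: "\<psi> \<in> Upper (H X Y) (hat_arr K X Y ` G)"
    have GH: "hat_arr K X Y ` G \<subseteq> carrier (H X Y)" using G by (auto intro: hat_arr_carrier)
    have c: "\<psi> \<in> carrier (H X Y)" using \<psi> by (auto simp: Upper_def)
    show "hat_arr K X Y (ksup X G) \<sqsubseteq>\<^bsub>H X Y\<^esub> \<psi>"
      unfolding le_H
    proof (intro allI ballI)
      fix V h assume h: "h \<in> carrier (arr K Y V)"
      have "cmp K X Y V h g \<sqsubseteq>\<^bsub>arr K X V\<^esub> \<psi> V h" if "g \<in> G" for g
      proof -
        have "hat_arr K X Y g \<sqsubseteq>\<^bsub>H X Y\<^esub> \<psi>"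
          using \<psi> that GH by (auto simp: Upper_def)
        then show ?thesis using h by (simp add: le_H hat_arr_app)
      qed
      moreover have "\<psi> V h \<in> carrier (arr K X V)"
        using in_carrier_H[OF c, of V] h by auto
      ultimately have "\<psi> V h \<in> Upper (arr K X V) ((\<lambda>g. cmp K X Y V h g) ` G)"
        by (auto simp: Upper_def)
      then show "hat_arr K X Y (ksup X G) V h \<sqsubseteq>\<^bsub>arr K X V\<^esub> \<psi> V h"
        using *[OF h] h by (auto simp: hat_arr_app least_def)
    qed
  next
    show "hat_arr K X Y ` G \<subseteq> carrier (H X Y)" "hat_arr K X Y (ksup X G) \<in> carrier (H X Y)"
      using G by (auto intro: hat_arr_carrier)
  qed
qed

text \<open>What \<open>Sigma_bang\<close> becomes when it is computed in \<open>K\<close>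
  itself.\<close>

definition saturation :: "'u set \<Rightarrow> ('u \<Rightarrow> ('a option \<times> 'm \<times> 'u) set) set
    \<Rightarrow> 'u \<Rightarrow> ('a option \<times> 'm \<times> 'u) set" where
  "saturation X G = ksup X (range (cpow K X (ksup X G)))"

lemma saturation_carrier [simp]:
  "G \<subseteq> carrier (arr K X X) \<Longrightarrow> saturation X G \<in> carrier (arr K X X)"
  unfolding saturation_def by (intro ksup_carrier_K) auto

text \<open>The embedding preserves identities, composites and unions, so each stage stays in its
  image: the finite joins, their supremum, the powers, and the supremum of the powers.\<close>

lemma Sigma_bang_eq:
  assumes G: "(farr \<pi> () ()) ` carrier N \<subseteq> carrier (arr K X X)" and X: "fobj \<pi> () = X"
  shows "Sigma_bang K N \<pi> = hat_arr K X X (saturation X (farr \<pi> () () ` carrier N))"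
proof -
  let ?G = "farr \<pi> () () ` carrier N" and ?hat = "hat_arr K X X"
  let ?F = "{F. finite F \<and> F \<noteq> {} \<and> F \<subseteq> ?G}"
  have FG: "F \<subseteq> carrier (arr K X X)" if "F \<in> ?F" for F
    using that G by blast
  have "finite_joins (H X X) (?hat ` ?G) = ?hat ` ksup X ` ?F"
  proof -
    \<comment> \<open>Finite sets of embedded arrows are images of finite sets of arrows, which
      moves the finite joins into \<open>K\<close>.\<close>
    have "{F. finite F \<and> F \<noteq> {} \<and> F \<subseteq> ?hat ` ?G} = (`) ?hat ` ?F"
    proof (intro equalityI subsetI)
      fix F assume F: "F \<in> {F. finite F \<and> F \<noteq> {} \<and> F \<subseteq> ?hat ` ?G}"
      then obtain C where "C \<subseteq> ?G" "finite C" "F = ?hat ` C"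
        using finite_subset_image[of F ?hat ?G] by blast
      then show "F \<in> (`) ?hat ` ?F" using F by blast
    qed blast
    then have "finite_joins (H X X) (?hat ` ?G) = (\<lambda>F. \<Squnion>\<^bsub>H X X\<^esub> F) ` (`) ?hat ` ?F"
      by (simp only: finite_joins_eq)
    also have "\<dots> = (\<lambda>F. \<Squnion>\<^bsub>H X X\<^esub> (?hat ` F)) ` ?F"
      by (rule image_image)
    also have "\<dots> = (\<lambda>F. ?hat (ksup X F)) ` ?F"
      using FG by (intro image_cong refl sup_hat_arr)
    also have "\<dots> = ?hat ` ksup X ` ?F"
      by (rule image_image[symmetric])
    finally show ?thesis .
  qed
  moreover have sub: "ksup X ` ?F \<subseteq> carrier (arr K X X)"
    using FG by (intro image_subsetI ksup_carrier_K)
  \<comment> \<open>The finite joins have the same union as the whole family, since joins of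
    singletons are among them.\<close>
  moreover have "ksup X (ksup X ` ?F) = ksup X ?G"
  proof -
    have "(\<Union>h\<in>ksup X ` ?F. h x) = (\<Union>g\<in>?G. g x)" if x: "x \<in> X" for x
    proof
      show "(\<Union>h\<in>ksup X ` ?F. h x) \<subseteq> (\<Union>g\<in>?G. g x)"
        using x by (auto simp: ksup_def)
      show "(\<Union>g\<in>?G. g x) \<subseteq> (\<Union>h\<in>ksup X ` ?F. h x)"
      proof (rule UN_least)
        fix g assume "g \<in> ?G"
        then have "ksup X {g} \<in> ksup X ` ?F" by (intro imageI) simp
        moreover have "g x = ksup X {g} x" using x by (simp add: ksup_def)
        ultimately show "g x \<subseteq> (\<Union>h\<in>ksup X ` ?F. h x)" by blast
      qed
    qed
    then show ?thesis
      by (simp add: ksup_def[of X ?G] ksup_def[of X "ksup X ` ?F"] cong: restrict_cong)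
  qed
  ultimately have S: "\<Squnion>\<^bsub>H X X\<^esub> (finite_joins (H X X) (?hat ` ?G)) = ?hat (ksup X ?G)"
    using sup_hat_arr[OF sub] by simp
  have P: "ksup X ?G \<in> carrier (arr K X X)"
    using G by simp
  have "range (cpow (hat_cat K) (hat_obj K X) (?hat (ksup X ?G)))
      = ?hat ` range (cpow K X (ksup X ?G))"
    unfolding image_image using P by (intro image_cong refl hat_arr_cpow)
  moreover have "range (cpow K X (ksup X ?G)) \<subseteq> carrier (arr K X X)"
    using P by (intro image_subsetI cpow_carrier_K)
  ultimately have "\<Squnion>\<^bsub>H X X\<^esub> (range (cpow (hat_cat K) (hat_obj K X) (?hat (ksup X ?G))))
      = ?hat (saturation X ?G)"
    unfolding saturation_def by (simp only: sup_hat_arr)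
  moreover have "(\<lambda>m. ?hat (farr \<pi> () () m)) ` carrier N = ?hat ` ?G"
    by (rule image_image[symmetric])
  ultimately show ?thesis
    by (simp only: Sigma_bang_def X Let_def S)
qed

section \<open>Weak bisimulations as a transfer property\<close>

lemma sharp_carrier: "f \<in> X \<rightarrow> Y \<Longrightarrow> sharp M X f \<in> carrier (arr K X Y)"
  by (auto simp: carrier_K sharp_def Sig_tau_def)

lemma cmp_sharp_left:
  assumes f: "f \<in> X \<rightarrow> Y" and P: "P \<in> carrier (arr K Z X)" and z: "z \<in> Z"
  shows "(\<sigma>, k, y) \<in> cmp K Z X Y (sharp M X f) P z \<longleftrightarrow> (\<exists>x. (\<sigma>, k, x) \<in> P z \<and> y = f x)"
proof
  assume "(\<sigma>, k, y) \<in> cmp K Z X Y (sharp M X f) P z"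
  then show "\<exists>x. (\<sigma>, k, x) \<in> P z \<and> y = f x"
    using in_carrier_K[OF P z] by (auto simp: cmp_K z sharp_def)
next
  assume "\<exists>x. (\<sigma>, k, x) \<in> P z \<and> y = f x"
  then obtain x where x: "(\<sigma>, k, x) \<in> P z" "y = f x" by blast
  then have "x \<in> X" "k \<in> carrier M" using in_carrier_K[OF P z] by auto
  then show "(\<sigma>, k, y) \<in> cmp K Z X Y (sharp M X f) P z"
    using cmp_K_I1[of z Z \<sigma> k x P \<one> y "sharp M X f" X Y] x z by (simp add: sharp_def)
qed

text \<open>The intermediate point is forced to be \<open>f x\<close>, and the unit contributes
  neither a visible label nor time.\<close>

lemma cmp_sharp_right:
  assumes f: "f \<in> X \<rightarrow> Y" and \<beta>: "\<beta> \<in> carrier (arr K Y Z)" and x: "x \<in> X"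
  shows "cmp K X Y Z \<beta> (sharp M X f) x = \<beta> (f x)"
proof -
  have fx: "f x \<in> Y" using f x by auto
  have "(\<sigma>, k, z) \<in> cmp K X Y Z \<beta> (sharp M X f) x \<longleftrightarrow> (\<sigma>, k, z) \<in> \<beta> (f x)" for \<sigma> k z
  proof
    assume "(\<sigma>, k, z) \<in> cmp K X Y Z \<beta> (sharp M X f) x"
    then show "(\<sigma>, k, z) \<in> \<beta> (f x)"
      using in_carrier_K[OF \<beta> fx] by (auto simp: cmp_K x sharp_def)
  next
    assume *: "(\<sigma>, k, z) \<in> \<beta> (f x)"
    then show "(\<sigma>, k, z) \<in> cmp K X Y Z \<beta> (sharp M X f) x"
      using cmp_K_I2[of x X \<one> "f x" "sharp M X f" \<sigma> k z \<beta> Y Z] in_carrier_K[OF \<beta> fx *]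
      by (simp add: sharp_def x)
  qed
  then show ?thesis by auto
qed

text \<open>Both sides of the defining equation are composites of embedded arrows, and
  \<open>Theta\<close> undoes the embedding.\<close>

lemma weak_behavioural_morphism_iff:
  assumes G: "(farr \<pi> () ()) ` carrier N \<subseteq> carrier (arr K X X)" and X: "fobj \<pi> () = X"
  defines "P \<equiv> saturation X (farr \<pi> () () ` carrier N)"
  shows "weak_behavioural_morphism Sig M N \<pi> Y f \<longleftrightarrow> f \<in> X \<rightarrow> Y \<and>
    (\<exists>\<beta>\<in>carrier (arr K Y Y). cmp K X X Y (sharp M X f) P = cmp K X Y Y \<beta> (sharp M X f))"
proof -
  have P: "P \<in> carrier (arr K X X)" using G by (simp add: P_def)
  show ?thesis
    unfolding weak_behavioural_morphism_def Let_def Sigma_bang_eq[OF G X] X P_def[symmetric]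
    by (intro conj_cong refl bex_cong)
      (simp_all add: hat_arr_cmp P sharp_carrier hat_arr_Theta)
qed

text \<open>The composite of \<beta> with \<open>sharp M X f\<close> depends on \<open>f x\<close>
  only, so the equation gives points with equal \<open>f\<close>-value the same steps of
  \<open>P\<close>, up to \<open>f\<close> on the targets. Conversely, let \<open>f\<close> choose
  class representatives and take \<beta> to be \<open>f\<close> after \<open>P\<close>.\<close>

lemma weak_bisimulation_iff:
  assumes lax: "lax_functor (monoid_cat N) K \<pi>" and X: "fobj \<pi> () = X" and R: "equiv X R"
  defines "P \<equiv> saturation X (farr \<pi> () () ` carrier N)"
  shows "weak_bisimulation Sig M N \<pi> R \<longleftrightarrow>
    (\<forall>x x' \<sigma> k y. (x, x') \<in> R \<longrightarrow> (\<sigma>, k, y) \<in> P x \<longrightarrow> (\<exists>y'. (\<sigma>, k, y') \<in> P x' \<and> (y, y') \<in> R))"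
    (is "_ \<longleftrightarrow> ?transfer")
proof -
  have G: "(farr \<pi> () ()) ` carrier N \<subseteq> carrier (arr K X X)"
    using lax X by (auto simp: lax_functor_def monoid_cat_def)
  have P: "P \<in> carrier (arr K X X)" using G by (simp add: P_def)
  have RX: "R \<subseteq> X \<times> X" using R by (simp add: equiv_type)
  note wbm = weak_behavioural_morphism_iff[OF G X, folded P_def]
  show ?thesis
  proof
    assume "weak_bisimulation Sig M N \<pi> R"
    then obtain Y f \<beta> where f: "f \<in> X \<rightarrow> Y" and \<beta>: "\<beta> \<in> carrier (arr K Y Y)"
      and eq: "cmp K X X Y (sharp M X f) P = cmp K X Y Y \<beta> (sharp M X f)"
      and Rf: "R = {(x, x'). x \<in> X \<and> x' \<in> X \<and> f x = f x'}"
      unfolding weak_bisimulation_def wbm X by blast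
    show ?transfer
    proof (intro allI impI)
      fix x x' \<sigma> k y assume xx: "(x, x') \<in> R" and y: "(\<sigma>, k, y) \<in> P x"
      have x: "x \<in> X" "x' \<in> X" "f x = f x'" using xx Rf by auto
      have "(\<sigma>, k, f y) \<in> cmp K X X Y (sharp M X f) P x"
        using y by (auto simp: cmp_sharp_left[OF f P x(1)])
      also have "\<dots> = cmp K X X Y (sharp M X f) P x'"
        unfolding eq using x by (simp add: cmp_sharp_right[OF f \<beta>])
      finally obtain y' where "(\<sigma>, k, y') \<in> P x'" "f y = f y'"
        by (auto simp: cmp_sharp_left[OF f P x(2)])
      moreover have "y \<in> X" "y' \<in> X"
        using in_carrier_K(3)[OF P] x y calculation by blast+
      ultimately show "\<exists>y'. (\<sigma>, k, y') \<in> P x' \<and> (y, y') \<in> R"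
        using Rf by blast
    qed
  next
    assume tr: ?transfer
    \<comment> \<open>A choice of class representatives: the predicate depends only on the class of
      \<open>x\<close>, so related points receive the same representative and the kernel of
      \<open>f\<close> is \<open>R\<close>.\<close>
    define f where "f = (\<lambda>x. SOME y. (x, y) \<in> R)"
    have fR: "(x, f x) \<in> R" if "x \<in> X" for x
      unfolding f_def using that R by (metis someI equiv_class_self Image_singleton_iff)
    have f: "f \<in> X \<rightarrow> X" using fR RX by auto
    have feq: "f x = f x' \<longleftrightarrow> (x, x') \<in> R" if "x \<in> X" "x' \<in> X" for x x'
    proof
      assume "f x = f x'"
      then show "(x, x') \<in> R"
        using fR[OF that(1)] fR[OF that(2)] R by (metis equivE symE transE)
    next
      assume "(x, x') \<in> R"
      then have "(x, y) \<in> R \<longleftrightarrow> (x', y) \<in> R" for y using R by (metis equivE symE transE)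
      then show "f x = f x'" by (simp add: f_def)
    qed
    let ?\<beta> = "cmp K X X X (sharp M X f) P"
    have \<beta>: "?\<beta> \<in> carrier (arr K X X)" using P f by (simp add: sharp_carrier)
    \<comment> \<open>Matched targets have equal representatives, so \<beta> respects classes;
      symmetry of \<open>R\<close> later gives equality.\<close>
    have sub: "?\<beta> x \<subseteq> ?\<beta> x'" if "(x, x') \<in> R" for x x'
    proof -
      have x: "x \<in> X" "x' \<in> X" using that RX by auto
      have "(\<sigma>, k, z) \<in> ?\<beta> x'" if z: "(\<sigma>, k, z) \<in> ?\<beta> x" for \<sigma> k z
      proof -
        obtain y where y: "(\<sigma>, k, y) \<in> P x" "z = f y"
          using z by (auto simp: cmp_sharp_left[OF f P x(1)])
        then obtain y' where y': "(\<sigma>, k, y') \<in> P x'" "(y, y') \<in> R"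
          using tr \<open>(x, x') \<in> R\<close> by blast
        then have "f y = f y'" using feq RX by blast
        then show ?thesis using y y' by (auto simp: cmp_sharp_left[OF f P x(2)])
      qed
      then show ?thesis by auto
    qed
    have "?\<beta> = cmp K X X X ?\<beta> (sharp M X f)"
    proof (rule carrier_K_eqI[OF \<beta>])
      show "cmp K X X X ?\<beta> (sharp M X f) \<in> carrier (arr K X X)"
        using \<beta> f by (simp add: sharp_carrier)
      fix x \<sigma> k y assume x: "x \<in> X"
      \<comment> \<open>Each point is related to its representative, so passing to the
        representative first does not change the value of \<beta>.\<close>
      have "(f x, x) \<in> R" using fR[OF x] R by (metis equivE symE)
      then have "?\<beta> (f x) = ?\<beta> x" using sub fR[OF x] by blast
      then show "(\<sigma>, k, y) \<in> ?\<beta> x \<longleftrightarrow> (\<sigma>, k, y) \<in> cmp K X X X ?\<beta> (sharp M X f) x"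
        by (simp add: cmp_sharp_right[OF f \<beta> x])
    qed
    then have "weak_behavioural_morphism Sig M N \<pi> X f"
      unfolding wbm using f \<beta> by blast
    moreover have "R = {(x, x'). x \<in> X \<and> x' \<in> X \<and> f x = f x'}"
      using feq RX by auto
    ultimately show "weak_bisimulation Sig M N \<pi> R"
      unfolding weak_bisimulation_def X using lax R by blast
  qed
qed

text \<open>The unit law of a lax functor puts the identity into the union, and the composition law
  closes the union under composition, so its powers add nothing.\<close>

lemma saturation_lax_functor:
  assumes lax: "lax_functor (monoid_cat N) K \<pi>" and X: "fobj \<pi> () = X" and N: "monoid N"
  shows "saturation X (farr \<pi> () () ` carrier N) = ksup X (farr \<pi> () () ` carrier N)"
    (is "_ = ksup X ?G")
proof -
  let ?P = "ksup X ?G"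
  have G: "?G \<subseteq> carrier (arr K X X)"
    using lax X by (auto simp: lax_functor_def monoid_cat_def)
  have P: "?P \<in> carrier (arr K X X)"
    using G by (rule ksup_carrier_K)
  have unit: "idn K X x \<subseteq> farr \<pi> () () \<one>\<^bsub>N\<^esub> x" if "x \<in> X" for x
    using lax X that by (simp add: lax_functor_def monoid_cat_def le_K)
  have comp: "cmp K X X X (farr \<pi> () () n) (farr \<pi> () () m) x \<subseteq> farr \<pi> () () (n \<otimes>\<^bsub>N\<^esub> m) x"
    if "x \<in> X" "m \<in> carrier N" "n \<in> carrier N" for x m n
    using lax X that by (simp add: lax_functor_def monoid_cat_def le_K)
  have le: "cpow K X ?P l x \<subseteq> ?P x" if x: "x \<in> X" for x l
  proof (induction l)
    case 0
    have "farr \<pi> () () \<one>\<^bsub>N\<^esub> \<in> ?G"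
      using N by (intro imageI) (rule monoid.one_closed)
    then have "farr \<pi> () () \<one>\<^bsub>N\<^esub> x \<subseteq> ?P x"
      by (simp only: ksup_def restrict_apply' x) (rule UN_upper)
    then show ?case using unit[OF x] by auto
  next
    case (Suc l)
    have "(\<sigma>, k, z) \<in> ?P x" if z: "(\<sigma>, k, z) \<in> cpow K X ?P (Suc l) x" for \<sigma> k z
    proof -
      obtain i j y where k: "k = i \<otimes> j" and
        y: "(\<sigma>, i, y) \<in> cpow K X ?P l x \<and> (None, j, z) \<in> ?P y \<or>
            (None, i, y) \<in> cpow K X ?P l x \<and> (\<sigma>, j, z) \<in> ?P y"
        using z unfolding cpow.simps cmp_K[OF x] by blast
      have yX: "y \<in> X"
        using y in_carrier_K(3)[OF cpow_carrier_K[OF P] x] by blast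
      have "(\<sigma>, i, y) \<in> ?P x \<and> (None, j, z) \<in> ?P y \<or> (None, i, y) \<in> ?P x \<and> (\<sigma>, j, z) \<in> ?P y"
        using y Suc.IH by blast
      \<comment> \<open>Each of the two steps comes from one index; the product of the indices in
        \<open>N\<close> serves for the composite.\<close>
      then obtain m n where mn: "m \<in> carrier N" "n \<in> carrier N" and
        "(\<sigma>, i, y) \<in> farr \<pi> () () m x \<and> (None, j, z) \<in> farr \<pi> () () n y \<or>
         (None, i, y) \<in> farr \<pi> () () m x \<and> (\<sigma>, j, z) \<in> farr \<pi> () () n y"
        unfolding ksup_iff[OF x] ksup_iff[OF yX] by blast
      then have "(\<sigma>, k, z) \<in> cmp K X X X (farr \<pi> () () n) (farr \<pi> () () m) x"
        unfolding cmp_K[OF x] using k by blast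
      then have "(\<sigma>, k, z) \<in> farr \<pi> () () (n \<otimes>\<^bsub>N\<^esub> m) x"
        using comp[OF x mn] by blast
      moreover have "n \<otimes>\<^bsub>N\<^esub> m \<in> carrier N"
        using N mn by (simp add: monoid.m_closed)
      ultimately show ?thesis using x by (auto simp: ksup_iff)
    qed
    then show ?case by auto
  qed
  \<comment> \<open>The first power gives the other inclusion.\<close>
  have "?P = cpow K X ?P (Suc 0)"
    using P by (simp add: cmp_idn_right)
  then have "?P x \<subseteq> saturation X ?G x" if "x \<in> X" for x
    using that unfolding saturation_def ksup_def[of X "range _"] by (simp only: restrict_apply') blast
  moreover have "saturation X ?G x \<subseteq> ?P x" if "x \<in> X" for x
    using that le unfolding saturation_def ksup_def[of X "range _"] by (simp only: restrict_apply') blast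
  ultimately show ?thesis
    using saturation_carrier[OF G] P by (intro antisym_K[of _ X X]) (auto simp: le_K)
qed

text \<open>Both laws hold with equality, as powers compose by adding exponents; monotonicity is
  immediate because a monoid is ordered by equality.\<close>

lemma lax_functor_cpow:
  assumes "f \<in> carrier (arr K X X)"
  shows "lax_functor (monoid_cat nat_add) K \<lparr>fobj = (\<lambda>_. X), farr = (\<lambda>_ _ n. cpow K X f n)\<rparr>"
  using assms by (simp add: lax_functor_def monoid_cat_def nat_add_def le_K cmp_cpow_K)

end

section \<open>Weak delays\<close>

lemma weak_tau_refl: "(x, x) \<in> weak_tau T"
  by (simp add: weak_tau_def)

text \<open>Every \<open>delay_seq\<close> begins with internal steps, so those that end the first
  sequence are absorbed by the second.\<close>

lemma delay_seq_append:
  "(x, y) \<in> delay_seq T ss \<Longrightarrow> (y, z) \<in> delay_seq T ts \<Longrightarrow> (x, z) \<in> delay_seq T (ss @ ts)"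
proof (induction ss arbitrary: x)
  case Nil
  then show ?case
    by (cases ts) (auto simp: weak_tau_def intro: rtrancl_trans)
next
  case (Cons s ss)
  then show ?case by auto
qed

lemma weak_delay_trans:
  assumes "(x, y) \<in> weak_delay T s" "(y, z) \<in> weak_delay T t"
  shows "(x, z) \<in> weak_delay T (s + t)"
proof -
  obtain ss ts where "set ss \<subseteq> {0<..}" "sum_list ss = s" "(x, y) \<in> delay_seq T ss"
    and "set ts \<subseteq> {0<..}" "sum_list ts = t" "(y, z) \<in> delay_seq T ts"
    using assms by (auto simp: weak_delay_def)
  then show ?thesis
    unfolding weak_delay_def by (intro UN_I[of "ss @ ts"]) (auto intro: delay_seq_append)
qed

text \<open>Only the empty sequence of positive delays has sum 0. Internal steps thus become delays
  of duration 0, and the two are treated as one family.\<close>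

lemma weak_delay_0: "weak_delay T 0 = weak_tau T"
proof -
  have "ts = []" if "set ts \<subseteq> {0<..}" "sum_list ts = 0" for ts :: "real list"
  proof (cases ts)
    case (Cons t us)
    then have "0 < t" "0 \<le> sum_list us"
      using that(1) by (auto simp: subset_iff less_imp_le intro!: sum_list_nonneg)
    then show ?thesis using that(2) Cons by simp
  qed
  then have "{ts. set ts \<subseteq> {0<..} \<and> sum_list ts = (0::real)} = {[]}"
    by auto
  then show ?thesis by (simp add: weak_delay_def)
qed

lemma weak_delay_nonneg: "(x, y) \<in> weak_delay T t \<Longrightarrow> 0 \<le> t"
  by (auto simp: weak_delay_def subset_iff less_imp_le intro!: sum_list_nonneg)

lemma weak_delay_refl: "(x, x) \<in> weak_delay T 0"
  by (simp add: weak_delay_0 weak_tau_refl)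

lemma weak_delay_step_tau: "(x, y) \<in> step T (Inl None) \<Longrightarrow> (x, y) \<in> weak_delay T 0"
  by (auto simp: weak_delay_0 weak_tau_def)

lemma weak_delay_step_delay:
  assumes "(x, y) \<in> step T (Inr r)" "0 < r"
  shows "(x, y) \<in> weak_delay T r"
  unfolding weak_delay_def using assms
  by (intro UN_I[of "[r]"]) (auto intro: weak_tau_refl)

section \<open>Moves with a label and a total duration\<close>

definition weak_action :: "('u, 'a) trans \<Rightarrow> 'a \<Rightarrow> real \<Rightarrow> ('u \<times> 'u) set" where
  "weak_action T a t =
     (\<Union>(t1, t2) \<in> {(t1, t2). t1 + t2 = t}. weak_delay T t1 O step T (Inl (Some a)) O weak_delay T t2)"

lemma weak_action_iff:
  "(x, y) \<in> weak_action T a t \<longleftrightarrow> (\<exists>t1 t2 u v. t = t1 + t2 \<and>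
     (x, u) \<in> weak_delay T t1 \<and> (u, v) \<in> step T (Inl (Some a)) \<and> (v, y) \<in> weak_delay T t2)"
  by (auto simp: weak_action_def)

text \<open>Weak delays have nonnegative duration, so a total of 0 forces both surrounding delays to
  consist of internal steps.\<close>

lemma weak_action_0: "weak_action T a 0 = weak_step T (Inl (Some a))"
proof (intro equalityI subrelI)
  fix x y assume "(x, y) \<in> weak_action T a 0"
  then obtain t1 t2 u v where t: "0 = t1 + t2" and u: "(x, u) \<in> weak_delay T t1"
    and v: "(u, v) \<in> step T (Inl (Some a))" and y: "(v, y) \<in> weak_delay T t2"
    unfolding weak_action_iff by blast
  have "t1 = 0" "t2 = 0"
    using t weak_delay_nonneg[OF u] weak_delay_nonneg[OF y] by auto
  then show "(x, y) \<in> weak_step T (Inl (Some a))"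
    using u v y by (auto simp: weak_delay_0)
next
  fix x y assume "(x, y) \<in> weak_step T (Inl (Some a))"
  then obtain u v where "(x, u) \<in> weak_delay T 0" "(u, v) \<in> step T (Inl (Some a))"
    "(v, y) \<in> weak_delay T 0"
    by (auto simp: weak_delay_0)
  moreover have "0 = 0 + (0 :: real)" by simp
  ultimately show "(x, y) \<in> weak_action T a 0"
    unfolding weak_action_iff by blast
qed

text \<open>These will turn out to be the steps of the saturation of
  \<open>alpha_functor\<close>.\<close>

definition weak_move :: "('u, 'a) trans \<Rightarrow> 'a option \<Rightarrow> real \<Rightarrow> ('u \<times> 'u) set" where
  "weak_move T \<sigma> t = (case \<sigma> of None \<Rightarrow> weak_delay T t | Some a \<Rightarrow> weak_action T a t)"

lemma weak_move_simps [simp]: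
  "weak_move T None t = weak_delay T t"
  "weak_move T (Some a) t = weak_action T a t"
  by (simp_all add: weak_move_def)

lemma weak_move_delay:
  assumes "(x, y) \<in> weak_move T \<sigma> s" "(y, z) \<in> weak_delay T t"
  shows "(x, z) \<in> weak_move T \<sigma> (s + t)"
proof (cases \<sigma>)
  case None
  then show ?thesis using assms by (auto intro: weak_delay_trans)
next
  case (Some a)
  then obtain s1 s2 u v where "s = s1 + s2" "(x, u) \<in> weak_delay T s1"
      "(u, v) \<in> step T (Inl (Some a))" "(v, y) \<in> weak_delay T s2"
    using assms(1) by (auto simp: weak_action_iff)
  moreover from this have "(v, z) \<in> weak_delay T (s2 + t)"
    using assms(2) by (blast intro: weak_delay_trans)
  ultimately show ?thesis using Some by (auto simp: weak_action_iff add.assoc)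
qed

text \<open>No weak delay has negative duration, so the time may range over all reals.\<close>

lemma abs_tau_eq: "abs_tau T = (\<Union>t. weak_delay T t)"
  using weak_delay_nonneg unfolding abs_tau_def by fast

lemma abs_step_eq: "abs_step T \<sigma> = (\<Union>t. weak_move T \<sigma> t)"
proof (cases \<sigma>)
  case None
  then show ?thesis by (simp add: abs_tau_eq)
next
  case (Some a)
  have "abs_step T (Some a) = (\<Union>t. weak_action T a t)"
  proof (intro equalityI subrelI)
    fix x y assume "(x, y) \<in> abs_step T (Some a)"
    then obtain t1 t2 u v where "(x, u) \<in> weak_delay T t1" "(u, v) \<in> step T (Inl (Some a))"
      "(v, y) \<in> weak_delay T t2"
      by (auto simp: abs_tau_eq)
    then have "(x, y) \<in> weak_action T a (t1 + t2)"
      unfolding weak_action_iff by blast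
    then show "(x, y) \<in> (\<Union>t. weak_action T a t)" by blast
  next
    fix x y assume "(x, y) \<in> (\<Union>t. weak_action T a t)"
    then obtain t1 t2 u v where "(x, u) \<in> weak_delay T t1" "(u, v) \<in> step T (Inl (Some a))"
      "(v, y) \<in> weak_delay T t2"
      by (auto simp: weak_action_iff)
    then show "(x, y) \<in> abs_step T (Some a)"
      by (auto simp: abs_tau_eq)
  qed
  then show ?thesis using Some by simp
qed

section \<open>The two functors of a timed transition system\<close>

locale timed_system =
  fixes Sig :: "'a set" and X :: "'u set" and T :: "('u, 'a) trans"
  assumes T: "T \<subseteq> X \<times> (Sig_tau Sig <+> {0<..}) \<times> X"
begin

sublocale kleisli_category nonneg_add Sig
  by unfold_locales (auto simp: nonneg_add_def)

lemma mult_nonneg_add [simp]: "s \<otimes>\<^bsub>nonneg_add\<^esub> t = s + t"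
  by (simp add: nonneg_add_def)

lemma one_nonneg_add [simp]: "\<one>\<^bsub>nonneg_add\<^esub> = 0"
  by (simp add: nonneg_add_def)

abbreviation \<alpha> :: "'u \<Rightarrow> ('a option \<times> real \<times> 'u) set" where
  "\<alpha> \<equiv> timed_alpha Sig X T"

lemma alpha_carrier: "\<alpha> \<in> carrier (arr K X X)"
  unfolding carrier_K using T by (auto simp: timed_alpha_def nonneg_add_def Sig_tau_def)

lemma alpha_iff:
  assumes "x \<in> X"
  shows "(\<sigma>, t, y) \<in> \<alpha> x \<longleftrightarrow>
    t = 0 \<and> (x, y) \<in> step T (Inl \<sigma>) \<or> \<sigma> = None \<and> t > 0 \<and> (x, y) \<in> step T (Inr t)"
  using assms T by (auto simp: timed_alpha_def step_def)

section \<open>Powers of \<alpha> and weak moves\<close>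

abbreviation \<alpha>_pow :: "nat \<Rightarrow> 'u \<Rightarrow> ('a option \<times> real \<times> 'u) set" where
  "\<alpha>_pow \<equiv> cpow K X \<alpha>"

lemma pow_carrier: "\<alpha>_pow n \<in> carrier (arr K X X)"
  using alpha_carrier by (rule cpow_carrier_K)

text \<open>Induction with the last \<alpha>-step split off: a silent one, internal or a delay,
  prolongs the move at its end, while a visible one takes no time and follows a silent move.\<close>

lemma pow_imp_weak_move:
  "x \<in> X \<Longrightarrow> (\<sigma>, t, z) \<in> \<alpha>_pow n x \<Longrightarrow> (x, z) \<in> weak_move T \<sigma> t"
proof (induction n arbitrary: \<sigma> t z)
  case 0
  then show ?case by (simp add: idn_K weak_delay_refl)
next
  case (Suc n)
  have delay: "(y, z) \<in> weak_delay T r" if "y \<in> X" "(None, r, z) \<in> \<alpha> y" for y z r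
    using that by (auto simp: alpha_iff intro: weak_delay_step_tau weak_delay_step_delay)
  obtain s r y where t: "t = s + r" and
    *: "(\<sigma>, s, y) \<in> \<alpha>_pow n x \<and> (None, r, z) \<in> \<alpha> y \<or> (None, s, y) \<in> \<alpha>_pow n x \<and> (\<sigma>, r, z) \<in> \<alpha> y"
    using Suc.prems by (auto simp: cmp_K)
  have y: "y \<in> X"
    using * in_carrier_K(3)[OF pow_carrier Suc.prems(1)] by blast
  show ?case
  proof (cases "(\<sigma>, s, y) \<in> \<alpha>_pow n x \<and> (None, r, z) \<in> \<alpha> y")
    case True
    then show ?thesis
      unfolding t using Suc.IH Suc.prems(1) y by (blast intro: weak_move_delay delay)
  next
    case False
    \<comment> \<open>For \<sigma> = \<open>None\<close> the two alternatives coincide, so failure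
      of the first leaves a visible label.\<close>
    with * have **: "(None, s, y) \<in> \<alpha>_pow n x" "(\<sigma>, r, z) \<in> \<alpha> y" "\<sigma> \<noteq> None"
      by metis+
    then obtain a where "\<sigma> = Some a" "r = 0" "(y, z) \<in> step T (Inl (Some a))"
      using y by (auto simp: alpha_iff)
    moreover have "(x, y) \<in> weak_delay T s"
      using Suc.IH[OF Suc.prems(1) **(1)] by simp
    \<comment> \<open>The delay after the action is the trivial one of duration 0.\<close>
    ultimately show ?thesis
      unfolding t by (auto simp: weak_action_iff) (metis add.right_neutral weak_delay_refl)
  qed
qed

lemma pow_comp1:
  assumes "x \<in> X" "(\<sigma>, s, y) \<in> \<alpha>_pow m x" "(None, t, z) \<in> \<alpha>_pow n y"
  shows "\<exists>k. (\<sigma>, s + t, z) \<in> \<alpha>_pow k x"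
  using cmp_K_I1[where Y=X and Z=X and f="\<alpha>_pow m" and g="\<alpha>_pow n", OF assms]
  by (auto simp: cmp_cpow_K[OF alpha_carrier])

lemma pow_comp2:
  assumes "x \<in> X" "(None, s, y) \<in> \<alpha>_pow m x" "(\<sigma>, t, z) \<in> \<alpha>_pow n y"
  shows "\<exists>k. (\<sigma>, s + t, z) \<in> \<alpha>_pow k x"
  using cmp_K_I2[where Y=X and Z=X and f="\<alpha>_pow m" and g="\<alpha>_pow n", OF assms]
  by (auto simp: cmp_cpow_K[OF alpha_carrier])

lemma pow_alpha: "(\<sigma>, t, y) \<in> \<alpha> x \<Longrightarrow> \<exists>n. (\<sigma>, t, y) \<in> \<alpha>_pow n x"
  by (intro exI[of _ "Suc 0"]) (simp add: cmp_idn_right[OF alpha_carrier])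

lemma weak_tau_imp_pow:
  assumes "(x, y) \<in> weak_tau T" "x \<in> X"
  shows "\<exists>n. (None, 0, y) \<in> \<alpha>_pow n x"
  using assms(1) unfolding weak_tau_def
proof (induction rule: rtrancl_induct)
  case base
  show ?case using assms(2) by (intro exI[of _ 0]) (simp add: idn_K)
next
  case (step y z)
  then obtain m where m: "(None, 0, y) \<in> \<alpha>_pow m x" by blast
  then have "y \<in> X" using in_carrier_K(3)[OF pow_carrier assms(2)] by blast
  then obtain n where "(None, 0, z) \<in> \<alpha>_pow n y"
    using step.hyps(2) pow_alpha[of None 0 z y] by (auto simp: alpha_iff)
  then show ?case using pow_comp1[OF assms(2) m, of 0 z n] by simp
qed

text \<open>Each delay, being positive, is a single \<alpha>-step; the internal steps in between
  contribute powers with time 0.\<close>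

lemma delay_seq_imp_pow:
  "(x, y) \<in> delay_seq T ts \<Longrightarrow> x \<in> X \<Longrightarrow> set ts \<subseteq> {0<..} \<Longrightarrow>
   \<exists>n. (None, sum_list ts, y) \<in> \<alpha>_pow n x"
proof (induction ts arbitrary: x)
  case Nil
  then show ?case by (simp add: weak_tau_imp_pow)
next
  case (Cons t ts)
  from Cons.prems(1) obtain u v where
    u: "(x, u) \<in> weak_tau T" and v: "(u, v) \<in> step T (Inr t)" and y: "(v, y) \<in> delay_seq T ts"
    by auto
  obtain l where l: "(None, 0, u) \<in> \<alpha>_pow l x"
    using weak_tau_imp_pow[OF u Cons.prems(2)] by blast
  have uX: "u \<in> X" and vX: "v \<in> X" using v T by (auto simp: step_def)
  obtain m where m: "(None, t, v) \<in> \<alpha>_pow m u"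
    using pow_alpha[of None t v u] v uX Cons.prems(3) by (auto simp: alpha_iff)
  obtain n where "(None, sum_list ts, y) \<in> \<alpha>_pow n v"
    using Cons.IH[OF y vX] Cons.prems(3) by auto
  then obtain k where k: "(None, t + sum_list ts, y) \<in> \<alpha>_pow k u"
    using pow_comp1[OF uX m] by blast
  show ?case using pow_comp1[OF Cons.prems(2) l k] by simp
qed

lemma weak_delay_imp_pow:
  "(x, y) \<in> weak_delay T t \<Longrightarrow> x \<in> X \<Longrightarrow> \<exists>n. (None, t, y) \<in> \<alpha>_pow n x"
  using delay_seq_imp_pow by (auto simp: weak_delay_def)

lemma weak_move_imp_pow:
  assumes "(x, y) \<in> weak_move T \<sigma> t" "x \<in> X"
  shows "\<exists>n. (\<sigma>, t, y) \<in> \<alpha>_pow n x"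
proof (cases \<sigma>)
  case None
  then show ?thesis using assms weak_delay_imp_pow by simp
next
  case (Some a)
  then obtain t1 t2 u v where t: "t = t1 + t2" and u: "(x, u) \<in> weak_delay T t1"
    and v: "(u, v) \<in> step T (Inl (Some a))" and y: "(v, y) \<in> weak_delay T t2"
    using assms(1) by (auto simp: weak_action_iff)
  have uX: "u \<in> X" and vX: "v \<in> X" using v T by (auto simp: step_def)
  obtain l where l: "(None, t1, u) \<in> \<alpha>_pow l x"
    using weak_delay_imp_pow[OF u assms(2)] by blast
  \<comment> \<open>The action itself takes time 0, so the two delays alone account for
    \<open>t\<close>.\<close>
  obtain m where m: "(\<sigma>, 0, v) \<in> \<alpha>_pow m u"
    using pow_alpha[of \<sigma> 0 v u] v uX Some by (auto simp: alpha_iff)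
  obtain n where n: "(None, t2, y) \<in> \<alpha>_pow n v"
    using weak_delay_imp_pow[OF y vX] by blast
  obtain k where "(\<sigma>, 0 + t2, y) \<in> \<alpha>_pow k u"
    using pow_comp1[OF uX m n] by blast
  then show ?thesis using pow_comp2[OF assms(2) l] t by simp
qed

lemma pow_iff: "x \<in> X \<Longrightarrow> (\<exists>n. (\<sigma>, t, y) \<in> \<alpha>_pow n x) \<longleftrightarrow> (x, y) \<in> weak_move T \<sigma> t"
  using pow_imp_weak_move weak_move_imp_pow by blast

text \<open>Time-abstract bisimulations only quantify over labels in \<open>Sig_tau Sig\<close>, the
  transfer property over all; labels outside the set have no moves.\<close>

lemma weak_move_label:
  assumes "(x, y) \<in> weak_move T \<sigma> t" "x \<in> X"
  shows "\<sigma> \<in> Sig_tau Sig"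
  using weak_move_imp_pow[OF assms] in_carrier_K(1)[OF pow_carrier assms(2)] by blast

lemma lax_functor_alpha: "lax_functor (monoid_cat nat_add) K (alpha_functor Sig X T)"
  unfolding alpha_functor_def using alpha_carrier by (rule lax_functor_cpow)

text \<open>The saturation is the union of the powers of \<alpha>, whose steps are the weak moves by
  \<open>pow_iff\<close>.\<close>

lemma weak_bisimulation_alpha_iff:
  assumes R: "equiv X R"
  shows "weak_bisimulation Sig nonneg_add nat_add (alpha_functor Sig X T) R \<longleftrightarrow>
    (\<forall>x x' \<sigma> t y. (x, x') \<in> R \<longrightarrow> (x, y) \<in> weak_move T \<sigma> t \<longrightarrow>
       (\<exists>y'. (x', y') \<in> weak_move T \<sigma> t \<and> (y, y') \<in> R))"
proof -
  let ?\<pi> = "alpha_functor Sig X T"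
  have X: "fobj ?\<pi> () = X" by (simp add: alpha_functor_def)
  have N: "monoid nat_add" by unfold_locales (auto simp: nat_add_def)
  have RX: "R \<subseteq> X \<times> X" using R by (simp add: equiv_type)
  have "(\<sigma>, t, y) \<in> ksup X (farr ?\<pi> () () ` carrier nat_add) x \<longleftrightarrow> (x, y) \<in> weak_move T \<sigma> t"
    if "x \<in> X" for \<sigma> t y x
    using that by (simp add: ksup_iff pow_iff[symmetric] alpha_functor_def nat_add_def)
  then show ?thesis
    unfolding weak_bisimulation_iff[OF lax_functor_alpha X R]
      saturation_lax_functor[OF lax_functor_alpha X N]
    using RX by (auto simp: subset_iff)
qed

text \<open>Timed steps are the weak moves that are silent or have duration 0. Any other move splits
  into a delay, an action and a delay, which are matched in turn.\<close>

lemma weak_timed_bisimulation_iff: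
  assumes R: "R \<subseteq> X \<times> X"
  shows "weak_timed_bisimulation Sig T R \<longleftrightarrow>
    (\<forall>x x' \<sigma> t y. (x, x') \<in> R \<longrightarrow> (x, y) \<in> weak_move T \<sigma> t \<longrightarrow>
       (\<exists>y'. (x', y') \<in> weak_move T \<sigma> t \<and> (y, y') \<in> R))" (is "_ \<longleftrightarrow> ?transfer")
proof
  assume tr: ?transfer
  have "\<exists>y'. (x', y') \<in> weak_step T l \<and> (y, y') \<in> R"
    if "(x, x') \<in> R" "(x, y) \<in> weak_step T l" for x x' y l
  proof -
    obtain \<sigma> t where "weak_step T l = weak_move T \<sigma> t"
    proof (cases l)
      case (Inl \<sigma>)
      then have "weak_step T l = weak_move T \<sigma> 0"
        by (cases \<sigma>) (simp_all add: weak_delay_0 weak_action_0)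
      then show ?thesis by (rule that)
    next
      case (Inr t)
      then have "weak_step T l = weak_move T None t" by simp
      then show ?thesis by (rule that)
    qed
    then show ?thesis using tr that by metis
  qed
  then show "weak_timed_bisimulation Sig T R"
    unfolding weak_timed_bisimulation_def by blast
next
  assume wtb: "weak_timed_bisimulation Sig T R"
  have delay: "\<exists>y'. (x', y') \<in> weak_delay T t \<and> (y, y') \<in> R"
    if "(x, x') \<in> R" "(x, y) \<in> weak_delay T t" for x x' t y
  proof (cases "t = 0")
    case True
    \<comment> \<open>Duration 0 is not a delay label; such a move is matched as internal
      steps.\<close>
    have "Inl None \<in> Sig_tau Sig <+> {0::real<..}" by (auto simp: Sig_tau_def)
    then show ?thesis
      using wtb that unfolding weak_timed_bisimulation_def True weak_delay_0
      by (metis weak_step.simps(1))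
  next
    case False
    then have "Inr t \<in> Sig_tau Sig <+> {0<..}"
      using weak_delay_nonneg[OF that(2)] by auto
    then show ?thesis
      using wtb that unfolding weak_timed_bisimulation_def by (metis weak_step.simps(3))
  qed
  show ?transfer
  proof (intro allI impI)
    fix x x' \<sigma> t y assume xx: "(x, x') \<in> R" and y: "(x, y) \<in> weak_move T \<sigma> t"
    show "\<exists>y'. (x', y') \<in> weak_move T \<sigma> t \<and> (y, y') \<in> R"
    proof (cases \<sigma>)
      case None
      then show ?thesis using xx y delay by simp
    next
      case (Some a)
      obtain t1 t2 u v where t: "t = t1 + t2" and u: "(x, u) \<in> weak_delay T t1"
        and v: "(u, v) \<in> step T (Inl (Some a))" and y: "(v, y) \<in> weak_delay T t2"
        using y Some by (auto simp: weak_action_iff)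
      obtain u' where u': "(x', u') \<in> weak_delay T t1" "(u, u') \<in> R"
        using delay[OF xx u] by blast
      have "Inl (Some a) \<in> Sig_tau Sig <+> {0::real<..}"
        using v T by (auto simp: step_def)
      moreover have "(u, v) \<in> weak_step T (Inl (Some a))"
        using v weak_tau_refl by fastforce
      ultimately obtain v' where v': "(u', v') \<in> weak_step T (Inl (Some a))" "(v, v') \<in> R"
        using wtb u'(2) unfolding weak_timed_bisimulation_def by blast
      obtain y' where y': "(v', y') \<in> weak_delay T t2" "(y, y') \<in> R"
        using delay[OF v'(2) y] by blast
      \<comment> \<open>The matching action brings internal steps on both sides. As delays of
        duration 0 they merge with the surrounding delays and leave the total unchanged.\<close>
      from v'(1) obtain p q where "(u', p) \<in> weak_delay T 0" "(p, q) \<in> step T (Inl (Some a))"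
          "(q, v') \<in> weak_delay T 0"
        by (auto simp: weak_delay_0)
      then have "(x', p) \<in> weak_delay T t1" "(p, q) \<in> step T (Inl (Some a))"
          "(q, y') \<in> weak_delay T t2"
        using weak_delay_trans[OF u'(1)] weak_delay_trans[OF _ y'(1)] by fastforce+
      then have "(x', y') \<in> weak_move T \<sigma> t"
        using t Some by (auto simp: weak_action_iff)
      then show ?thesis using y'(2) by blast
    qed
  qed
qed

section \<open>The functor with time in the index, and time-abstract bisimulations\<close>

lemma rho_carrier:
  "farr (rho_functor Sig X T) () () p \<in> carrier (arr (kleisli Sig (singleton_group ())) X X)"
  using pow_carrier[of "fst p"]
  by (auto simp: rho_functor_def carrier_K kleisli_def PiE_iff split: prod.splits) fastforce+

text \<open>Composing at the indices \<open>(m, s)\<close> and \<open>(n, t)\<close> fixes how the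
  total time is divided, while the power \<open>n + m\<close> with time \<open>t + s\<close> admits
  any division; so the composition law is in general only an inclusion.\<close>

lemma lax_functor_rho:
  "lax_functor (monoid_cat (nat_add \<times>\<times> nonneg_add)) (kleisli Sig (singleton_group ()))
     (rho_functor Sig X T)"
proof -
  \<comment> \<open>Facts with prefix \<open>U\<close> concern the one-element monoid; those without
    it concern the monoid of durations.\<close>
  interpret U: kleisli_category "singleton_group ()" Sig
    using group.is_monoid[OF singleton_group] by (simp add: kleisli_category_def)
  let ?\<rho> = "\<lambda>n t. farr (rho_functor Sig X T) () () (n, t)"
  have \<rho>_iff: "(\<sigma>, v, y) \<in> ?\<rho> n t x \<longleftrightarrow> (\<sigma>, t, y) \<in> \<alpha>_pow n x" if "x \<in> X" for \<sigma> v y n t x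
    using that by (simp add: rho_functor_def)
  have "idn (kleisli Sig (singleton_group ())) X x \<subseteq> ?\<rho> 0 0 x" if "x \<in> X" for x
    using that by (auto simp: U.idn_K \<rho>_iff idn_K)
  moreover have "cmp (kleisli Sig (singleton_group ())) X X X (?\<rho> n t) (?\<rho> m s) x
      \<subseteq> ?\<rho> (n + m) (t + s) x" if x: "x \<in> X" for m s n t x
  proof -
    have "(\<sigma>, v, z) \<in> ?\<rho> (n + m) (t + s) x"
      if h: "(\<sigma>, v, z) \<in> cmp (kleisli Sig (singleton_group ())) X X X (?\<rho> n t) (?\<rho> m s) x" for \<sigma> v z
    proof -
      obtain y where
        y: "(\<sigma>, (), y) \<in> ?\<rho> m s x \<and> (None, (), z) \<in> ?\<rho> n t y \<or>
            (None, (), y) \<in> ?\<rho> m s x \<and> (\<sigma>, (), z) \<in> ?\<rho> n t y"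
        using h unfolding U.cmp_K[OF x] by auto
      then have yX: "y \<in> X" using in_carrier_K(3)[OF pow_carrier x] x by (auto simp: \<rho>_iff)
      \<comment> \<open>Putting the durations back into the two steps gives a composite of powers of
        \<alpha>.\<close>
      have "(\<sigma>, s + t, z) \<in> cmp K X X X (\<alpha>_pow n) (\<alpha>_pow m) x"
        using y x yX by (auto simp: \<rho>_iff cmp_K)
      then show ?thesis using x by (simp add: cmp_cpow_K[OF alpha_carrier] \<rho>_iff add.commute)
    qed
    then show ?thesis by auto
  qed
  ultimately show ?thesis
    using rho_carrier
    by (auto simp: lax_functor_def monoid_cat_def nat_add_def nonneg_add_def U.le_K rho_functor_def)
qed

text \<open>The union over all indices \<open>(n, t)\<close> forgets the time, which turns the weak
  moves found by \<open>pow_iff\<close> into time-abstract steps.\<close>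

lemma weak_bisimulation_rho_iff:
  assumes R: "equiv X R"
  shows "weak_bisimulation Sig (singleton_group ()) (nat_add \<times>\<times> nonneg_add) (rho_functor Sig X T) R
    \<longleftrightarrow> weak_time_abstract_bisimulation Sig T R"
proof -
  interpret U: kleisli_category "singleton_group ()" Sig
    using group.is_monoid[OF singleton_group] by (simp add: kleisli_category_def)
  let ?\<pi> = "rho_functor Sig X T"
  have X: "fobj ?\<pi> () = X" by (simp add: rho_functor_def)
  have N: "monoid (nat_add \<times>\<times> nonneg_add)"
    by (rule DirProd_monoid) (unfold_locales, auto simp: nat_add_def nonneg_add_def)
  have RX: "R \<subseteq> X \<times> X" using R by (simp add: equiv_type)
  let ?P = "ksup X (farr ?\<pi> () () ` carrier (nat_add \<times>\<times> nonneg_add))"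
  have P: "(\<sigma>, v, y) \<in> ?P x \<longleftrightarrow>
      (x, y) \<in> abs_step T \<sigma>" if x: "x \<in> X" for \<sigma> v y x
  proof -
    have "(\<sigma>, v, y) \<in> ?P x \<longleftrightarrow>
        (\<exists>t\<ge>0. \<exists>n. (\<sigma>, t, y) \<in> \<alpha>_pow n x)"
      using x by (auto simp: ksup_iff rho_functor_def nat_add_def nonneg_add_def)
    \<comment> \<open>Times that occur in a power lie in the carrier of
      \<open>nonneg_add\<close>.\<close>
    also have "\<dots> \<longleftrightarrow> (\<exists>t n. (\<sigma>, t, y) \<in> \<alpha>_pow n x)"
    proof -
      have "0 \<le> t" if "(\<sigma>, t, y) \<in> \<alpha>_pow n x" for t n
        using in_carrier_K(2)[OF pow_carrier x that] by (simp add: nonneg_add_def)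
      then show ?thesis by blast
    qed
    finally show ?thesis using x by (simp add: pow_iff abs_step_eq)
  qed
  have label: "\<sigma> \<in> Sig_tau Sig" if "(x, y) \<in> abs_step T \<sigma>" "x \<in> X" for x y \<sigma>
    using that weak_move_label by (auto simp: abs_step_eq)
  show ?thesis
    unfolding U.weak_bisimulation_iff[OF lax_functor_rho X R]
      U.saturation_lax_functor[OF lax_functor_rho X N] weak_time_abstract_bisimulation_def
  proof (intro iffI allI ballI impI)
    fix x x' y \<sigma>
    assume tr: "\<forall>x x' \<sigma> k y. (x, x') \<in> R \<longrightarrow> (\<sigma>, k, y) \<in> ?P x \<longrightarrow>
        (\<exists>y'. (\<sigma>, k, y') \<in> ?P x' \<and> (y, y') \<in> R)"
      and xx: "(x, x') \<in> R" and y: "(x, y) \<in> abs_step T \<sigma>"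
    have x: "x \<in> X" "x' \<in> X" using xx RX by auto
    obtain y' where "(\<sigma>, (), y') \<in> ?P x'" "(y, y') \<in> R"
      using tr xx y P[OF x(1)] by blast
    then show "\<exists>y'. (x', y') \<in> abs_step T \<sigma> \<and> (y, y') \<in> R"
      using P[OF x(2)] by blast
  next
    fix x x' \<sigma> k y
    assume wtab: "\<forall>x x' y. \<forall>\<sigma>\<in>Sig_tau Sig. (x, x') \<in> R \<longrightarrow> (x, y) \<in> abs_step T \<sigma> \<longrightarrow>
        (\<exists>y'. (x', y') \<in> abs_step T \<sigma> \<and> (y, y') \<in> R)"
      and xx: "(x, x') \<in> R" and y: "(\<sigma>, k, y) \<in> ?P x"
    have x: "x \<in> X" "x' \<in> X" using xx RX by auto
    have "(x, y) \<in> abs_step T \<sigma>" using y P[OF x(1)] by blast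
    then obtain y' where "(x', y') \<in> abs_step T \<sigma>" "(y, y') \<in> R"
      using wtab xx label[OF _ x(1)] by blast
    then show "\<exists>y'. (\<sigma>, k, y') \<in> ?P x' \<and> (y, y') \<in> R"
      using P[OF x(2)] by blast
  qed
qed

end

theorem theorem4p9:
  fixes Sig :: "'a set" and X :: "'u set"
    and T :: "('u \<times> ('a option + real) \<times> 'u) set" and R :: "('u \<times> 'u) set"
  assumes T: "T \<subseteq> X \<times> (Sig_tau Sig <+> {0<..}) \<times> X"
    and R: "equiv X R"
  shows "(weak_bisimulation Sig nonneg_add nat_add (alpha_functor Sig X T) R
            \<longleftrightarrow> weak_timed_bisimulation Sig T R) \<and>
         (weak_bisimulation Sig (singleton_group ()) (nat_add \<times>\<times> nonneg_add) (rho_functor Sig X T) R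
            \<longleftrightarrow> weak_time_abstract_bisimulation Sig T R)"
proof -
  interpret timed_system Sig X T using T by unfold_locales
  show ?thesis
    using R by (simp add: weak_bisimulation_alpha_iff weak_timed_bisimulation_iff equiv_type
        weak_bisimulation_rho_iff)
qed

end
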